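(* Let $(R,\mathfrak m)$ be a Noetherian local ring, $I$ an $\mathfrak m$-primary ideal of $R$, and $M$ a finitely generated $R$-module of dimension $t$. Let $\mathrm e_I^0(M)$ be the Hilbert multiplicity and $\mathrm f_I^0(M)$ the irreducible multiplicity of $M$ with respect to $I$. Then \[ \mathrm f_I^0(M) \le \begin{cases} \mathrm e_I^0(M) & \text{if } t\ne 1,\\ \mathrm e_I^0(M) + \ell_R\big((0):_M \mathfrak m\big) & \text{if } t=1. \end{cases} \] Furthermore, equality holds if $\mathfrak m = I^{n+1}M :_R I^nM$ for some $n\ge 0$.
   Context: $\ell_R$ denotes length. For submodules $N,N'$ of $M$ and an ideal $J$ of $R$, $N:_M J=\{x\in M : Jx\subseteq N\}$ and $N:_R N'=\{a\in R : aN'\subseteq N\}$. The module $M$ is nonzero, so $t\ge 0$. For $n\gg 0$, $\ell_R(M/I^{n+1}M)$ agrees with a polynomial in $n$ of degree $t$, written \[ \ell_R(M/I^{n+1}M)=\mathrm e_I^0(M)\binom{n+t}{t}-\mathrm e_I^1(M)\binom{n+t-1}{t-1}+\cdots+(-1)^t\mathrm e_I^t(M) \] with integers $\mathrm e_I^i(M)$; the coefficient $\mathrm e_I^0(M)$ is the Hilbert multiplicity of $M$ with respect to $I$. It is also known that, for $t\ge 1$, there are integers $\mathrm f_I^i(M)$ such that for $n\gg 0$ \[ \ell_R\big((I^{n+1}M:_M\mathfrak m)/I^{n+1}M\big)=\mathrm f_I^0(M)\binom{n+t-1}{t-1}-\mathrm f_I^1(M)\binom{n+t-2}{t-2}+\cdots+(-1)^{t-1}\mathrm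 f_I^{t-1}(M); \] the coefficient $\mathrm f_I^0(M)$ is the irreducible multiplicity of $M$ with respect to $I$. For $t=0$ the convention is $\mathrm f_I^0(M)=\ell_R((0):_M\mathfrak m)$ (the value of $\ell_R\big((I^{n+1}M:_M\mathfrak m)/I^{n+1}M\big)$ for $n\gg 0$).
   Formalization: The equality statement is asserted only for t ≥ 1, since it fails for t = 0: for R = M = k[x]/(x^2) and I = m = (x), the condition holds with n = 0, but the irreducible multiplicity is 1 and the Hilbert multiplicity is 2. *)

theory Defs
  imports
    "HOL-Algebra.Module"
    "HOL-Algebra.Ideal_Product"
    "HOL-Algebra.Ring_Divisibility"
    "HOL-Library.Extended_Real"
begin

section \<open>Rings and ideals\<close>

definition noetherian_local_ring :: "('a, 'r) ring_scheme \<Rightarrow> 'a set \<Rightarrow> bool" where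
  "noetherian_local_ring R \<mm> \<longleftrightarrow>
     cring R \<and> noetherian_ring R \<and> maximalideal \<mm> R \<and> (\<forall>J. maximalideal J R \<longrightarrow> J = \<mm>)"

definition primary_ideal :: "('a, 'r) ring_scheme \<Rightarrow> 'a set \<Rightarrow> bool" where
  "primary_ideal R I \<longleftrightarrow>
     ideal I R \<and> I \<noteq> carrier R \<and>
     (\<forall>a\<in>carrier R. \<forall>b\<in>carrier R. a \<otimes>\<^bsub>R\<^esub> b \<in> I \<longrightarrow> a \<in> I \<or> (\<exists>n::nat. b [^]\<^bsub>R\<^esub> n \<in> I))"

definition radical_ideal :: "('a, 'r) ring_scheme \<Rightarrow> 'a set \<Rightarrow> 'a set" where
  "radical_ideal R I = {a \<in> carrier R. \<exists>n::nat. a [^]\<^bsub>R\<^esub> n \<in> I}"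

definition primary_to :: "('a, 'r) ring_scheme \<Rightarrow> 'a set \<Rightarrow> 'a set \<Rightarrow> bool" where
  "primary_to R \<pp> I \<longleftrightarrow> primary_ideal R I \<and> radical_ideal R I = \<pp>"

text \<open>The supremum in \<^typ>\<open>enat\<close> gives the zero ring dimension 0 (usually it is negative
  infinity or undefined); the convention is immaterial for nonzero rings.\<close>

definition krull_dim :: "('a, 'r) ring_scheme \<Rightarrow> enat" where
  "krull_dim R =
     Sup {enat n | n. \<exists>P :: nat \<Rightarrow> 'a set.
            (\<forall>i\<le>n. primeideal (P i) R) \<and> (\<forall>i<n. P i \<subset> P (Suc i))}"

section \<open>Modules\<close>

definition finitely_generated_module ::
    "('a, 'r) ring_scheme \<Rightarrow> ('a, 'b, 'm) module_scheme \<Rightarrow> bool" where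
  "finitely_generated_module R M \<longleftrightarrow>
     module R M \<and>
     (\<exists>A. finite A \<and> A \<subseteq> carrier M \<and> (\<forall>N. submodule N R M \<and> A \<subseteq> N \<longrightarrow> N = carrier M))"

definition module_length :: "('a, 'r) ring_scheme \<Rightarrow> ('a, 'b, 'm) module_scheme \<Rightarrow> enat" where
  "module_length R M =
     Sup {enat n | n. \<exists>N :: nat \<Rightarrow> 'b set.
            (\<forall>i\<le>n. submodule (N i) R M) \<and> (\<forall>i<n. N i \<subset> N (Suc i))}"

text \<open>The record type of modules extends that of rings, so it carries fields for a
  multiplication and a unit that play no role for modules; they are left undefined.\<close>

definition quotient_module :: "('a, 'b, 'm) module_scheme \<Rightarrow> 'b set \<Rightarrow> ('a, 'b set) module" where
  "quotient_module M N =
     \<lparr>carrier = a_rcosets\<^bsub>M\<^esub> N, monoid.mult = undefined, one = undefined, zero = N, add = set_add M,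
      smult = (\<lambda>a X. \<Union>x\<in>X. N +>\<^bsub>M\<^esub> (a \<odot>\<^bsub>M\<^esub> x))\<rparr>"

text \<open>The quotient of a submodule \<open>L\<close> of \<open>M\<close> by a submodule \<open>N \<subseteq> L\<close>.\<close>

abbreviation subquotient_module ::
    "('a, 'b, 'm) module_scheme \<Rightarrow> 'b set \<Rightarrow> 'b set \<Rightarrow> ('a, 'b set) module" where
  "subquotient_module M L N \<equiv> quotient_module (M\<lparr>carrier := L\<rparr>) N"

text \<open>The submodule \<open>J N\<close>, in the style of \<^const>\<open>ideal_prod\<close>.  Closure under addition
  suffices, because \<open>J\<close> and \<open>N\<close> are meant to be an ideal and a submodule.\<close>

inductive_set ideal_smult :: "('a, 'b, 'm) module_scheme \<Rightarrow> 'a set \<Rightarrow> 'b set \<Rightarrow> 'b set"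
  for M and J and N where
    smult: "\<lbrakk>a \<in> J; x \<in> N\<rbrakk> \<Longrightarrow> a \<odot>\<^bsub>M\<^esub> x \<in> ideal_smult M J N"
  | add: "\<lbrakk>x \<in> ideal_smult M J N; y \<in> ideal_smult M J N\<rbrakk> \<Longrightarrow> x \<oplus>\<^bsub>M\<^esub> y \<in> ideal_smult M J N"

text \<open>The submodule \<open>I\<^sup>n M\<close>; ideal powers are powers in the monoid \<^const>\<open>ideals_set\<close>,
  whose unit is the unit ideal.\<close>

definition ideal_power_module ::
    "('a, 'r) ring_scheme \<Rightarrow> 'a set \<Rightarrow> nat \<Rightarrow> ('a, 'b, 'm) module_scheme \<Rightarrow> 'b set" where
  "ideal_power_module R I n M = ideal_smult M (I [^]\<^bsub>ideals_set R\<^esub> n) (carrier M)"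

text \<open>\<open>N :\<^sub>M J\<close> and \<open>N :\<^sub>R N'\<close>\<close>

definition colon_module :: "('a, 'b, 'm) module_scheme \<Rightarrow> 'b set \<Rightarrow> 'a set \<Rightarrow> 'b set" where
  "colon_module M N J = {x \<in> carrier M. \<forall>a\<in>J. a \<odot>\<^bsub>M\<^esub> x \<in> N}"

definition colon_ring ::
    "('a, 'r) ring_scheme \<Rightarrow> ('a, 'b, 'm) module_scheme \<Rightarrow> 'b set \<Rightarrow> 'b set \<Rightarrow> 'a set" where
  "colon_ring R M N N' = {a \<in> carrier R. \<forall>x\<in>N'. a \<odot>\<^bsub>M\<^esub> x \<in> N}"

definition annihilator :: "('a, 'r) ring_scheme \<Rightarrow> ('a, 'b, 'm) module_scheme \<Rightarrow> 'a set" where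
  "annihilator R M = colon_ring R M {\<zero>\<^bsub>M\<^esub>} (carrier M)"

definition module_dim :: "('a, 'r) ring_scheme \<Rightarrow> ('a, 'b, 'm) module_scheme \<Rightarrow> enat" where
  "module_dim R M = krull_dim (R Quot annihilator R M)"

text \<open>The length of the socle \<open>(0) :\<^sub>M \<mm>\<close>.\<close>

definition socle_length ::
    "('a, 'r) ring_scheme \<Rightarrow> 'a set \<Rightarrow> ('a, 'b, 'm) module_scheme \<Rightarrow> enat" where
  "socle_length R \<mm> M = module_length R (M\<lparr>carrier := colon_module M {\<zero>\<^bsub>M\<^esub>} \<mm>\<rparr>)"

section \<open>Hilbert and irreducible coefficients\<close>

text \<open>Both predicates are used for a nonzero finitely generated module \<open>M\<close> of dimension \<open>t\<close>
  over a Noetherian local ring and an \<open>\<mm>\<close>-primary ideal \<open>I\<close>.  They determine \<open>e i\<close> for \<open>i \<le> t\<close>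
  and \<open>f i\<close> for \<open>i < t\<close> (and \<open>f 0\<close> for \<open>t = 0\<close>) uniquely; other values are irrelevant.
  The Hilbert multiplicity is \<open>e 0\<close>, the irreducible multiplicity is \<open>f 0\<close>.  Comparing in
  \<^typ>\<open>ereal\<close> makes finiteness of the lengths part of the conditions.\<close>

definition hilbert_coefficients ::
    "('a, 'r) ring_scheme \<Rightarrow> 'a set \<Rightarrow> ('a, 'b, 'm) module_scheme \<Rightarrow> nat \<Rightarrow> (nat \<Rightarrow> int) \<Rightarrow> bool"
  where
  "hilbert_coefficients R I M t e \<longleftrightarrow>
     (\<forall>\<^sub>F n in sequentially.
        ereal_of_enat (module_length R (quotient_module M (ideal_power_module R I (n + 1) M))) =
        ereal (real_of_int (\<Sum>i\<le>t. (-1) ^ i * e i * int ((n + t - i) choose (t - i)))))"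

definition irreducible_coefficients ::
    "('a, 'r) ring_scheme \<Rightarrow> 'a set \<Rightarrow> 'a set \<Rightarrow> ('a, 'b, 'm) module_scheme \<Rightarrow> nat
      \<Rightarrow> (nat \<Rightarrow> int) \<Rightarrow> bool"
  where
  "irreducible_coefficients R \<mm> I M t f \<longleftrightarrow>
     (if t = 0 then ereal_of_enat (socle_length R \<mm> M) = ereal (real_of_int (f 0))
      else (\<forall>\<^sub>F n in sequentially.
        ereal_of_enat (module_length R
          (subquotient_module M (colon_module M (ideal_power_module R I (n + 1) M) \<mm>)
             (ideal_power_module R I (n + 1) M))) =
        ereal (real_of_int
          (\<Sum>i<t. (-1) ^ i * f i * int ((n + (t - 1) - i) choose (t - 1 - i))))))"

end

theory Submission
  imports Defs
begin

text \<open>Write \<open>P n\<close> for \<open>I\<^sup>n M\<close> and \<open>S\<close> for the socle \<open>0 :\<^sub>M \<mm>\<close>.  For large \<open>n\<close> we have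
  \<open>P n \<inter> S = 0\<close> and \<open>(P (n + 1) :\<^sub>M \<mm>) \<subseteq> P n + S\<close>, so the length of
  \<open>(P (n + 1) :\<^sub>M \<mm>) / P (n + 1)\<close> is at most that of \<open>P n / P (n + 1)\<close> plus that of \<open>S\<close>.  Both
  sides are polynomials in \<open>n\<close> of degree \<open>t - 1\<close>, and comparing leading coefficients gives the bound;
  the constant \<open>\<ell>(S)\<close> matters only for \<open>t = 1\<close>.  If \<open>\<mm> = P (m + 1) :\<^sub>R P m\<close> for some \<open>m\<close>, then
  \<open>\<mm> P n \<subseteq> P (n + 1)\<close> for all \<open>n \<ge> m\<close> and the inclusion is an equality.  For \<open>t = 0\<close> the socle
  embeds into \<open>M / P (n + 1)\<close>.

  The inclusion comes from the Noetherian property of the Rees module: a family of submodules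
  \<open>N n \<subseteq> P n\<close> with \<open>I N n \<subseteq> N (n + 1)\<close> satisfies \<open>N (n + 1) = I N n\<close> for large \<open>n\<close>.\<close>

section \<open>Lengths of chains of sets\<close>

text \<open>The inclusion \<open>(P (n + 1) :\<^sub>M \<mm>) \<subseteq> P n + S\<close> is the
  heart, and it takes two arguments. An Artin-Rees argument, applied to one generator of
  \<open>\<mm>\<close> at a time, only places an element of the colon in
  \<open>P (k + 1) + S\<close> for a fixed \<open>k\<close>. To reach \<open>P n\<close>,
  stabilization is applied to \<open>N n = (P (n + 2) :\<^sub>M \<mm>) \<inter> P n\<close>: for
  large \<open>n\<close> it gives \<open>N (n + 1) = I N n \<subseteq> \<mm> N n \<subseteq> P (n +
  2)\<close>, so the part in \<open>P (k + 1)\<close> climbs one degree at a time as long as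
  \<open>\<mm>\<close> sends it deep enough. The Noetherian property of the Rees module is Hilbert's
  basis theorem carried out on graded families of submodules of \<open>M\<close>, with one generator
  of \<open>I\<close> adjoined at each step; neither polynomials nor a Rees algebra are constructed.
  Lengths are treated as lengths of intervals in the lattice of submodules, so that the isomorphism
  theorems become monotone injections between intervals.\<close>

definition is_strict_chain :: "'c set set \<Rightarrow> nat \<Rightarrow> (nat \<Rightarrow> 'c set) \<Rightarrow> bool" where
  "is_strict_chain S n N \<longleftrightarrow> (\<forall>i\<le>n. N i \<in> S) \<and> (\<forall>i<n. N i \<subset> N (Suc i))"

definition chain_length :: "'c set set \<Rightarrow> enat" where
  "chain_length S = Sup {enat n | n. \<exists>N. is_strict_chain S n N}"

lemma module_length_eq_chain_length:
  "module_length R M = chain_length {N. submodule N R M}"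
  by (simp add: module_length_def chain_length_def is_strict_chain_def)

lemma chain_length_le_iff:
  "chain_length S \<le> c \<longleftrightarrow> (\<forall>n N. is_strict_chain S n N \<longrightarrow> enat n \<le> c)"
  unfolding chain_length_def by (auto simp: Sup_le_iff)

lemma le_chain_length: "is_strict_chain S n N \<Longrightarrow> enat n \<le> chain_length S"
  using chain_length_le_iff by blast

lemma is_strict_chain_shorten:
  assumes "is_strict_chain S n N" "m \<le> n"
  shows "is_strict_chain S m N"
  using assms by (auto simp: is_strict_chain_def)

text \<open>Strict chains can be truncated, so without one of length \<open>n\<close> all lengths
  are below \<open>n\<close>, and so is their supremum. Nonemptiness provides the chain of length
  0.\<close>

lemma enat_le_chain_length_imp:
  assumes "enat n \<le> chain_length S" "S \<noteq> {}"
  shows "\<exists>N. is_strict_chain S n N"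
proof (rule ccontr)
  assume no: "\<not> ?thesis"
  obtain X where "X \<in> S" using assms(2) by blast
  then have "is_strict_chain S 0 (\<lambda>_. X)"
    by (simp add: is_strict_chain_def)
  with no have n: "n \<noteq> 0" by metis
  have "chain_length S \<le> enat (n - 1)"
    unfolding chain_length_le_iff
    using no is_strict_chain_shorten by (metis enat_ord_simps(1) le_diff_conv not_less_eq_eq
        Suc_eq_plus1 linorder_le_cases Suc_pred' gr0I n)
  with assms(1) have "enat n \<le> enat (n - 1)" by (rule order_trans)
  with n show False by simp
qed

text \<open>Injectivity keeps strict inclusions strict. Two applications in opposite directions
  serve in place of an isomorphism of lattices.\<close>

lemma chain_length_inj_mono:
  assumes "\<And>X. X \<in> S \<Longrightarrow> h X \<in> T"
    and "\<And>X Y. X \<in> S \<Longrightarrow> Y \<in> S \<Longrightarrow> X \<subseteq> Y \<Longrightarrow> h X \<subseteq> h Y"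
    and "inj_on h S"
  shows "chain_length S \<le> chain_length T"
  unfolding chain_length_le_iff
proof (intro allI impI)
  fix n N assume N: "is_strict_chain S n N"
  have "is_strict_chain T n (\<lambda>i. h (N i))"
    unfolding is_strict_chain_def
  proof (intro conjI allI impI)
    fix i assume "i < n"
    then have "N i \<in> S" "N (Suc i) \<in> S" "N i \<subset> N (Suc i)"
      using N by (auto simp: is_strict_chain_def)
    then show "h (N i) \<subset> h (N (Suc i))"
      using assms(2)[of "N i" "N (Suc i)"] inj_onD[OF assms(3), of "N i" "N (Suc i)"] by blast
  qed (use assms(1) N in \<open>auto simp: is_strict_chain_def\<close>)
  then show "enat n \<le> chain_length T" by (rule le_chain_length)
qed

lemma chain_length_mono: "S \<subseteq> T \<Longrightarrow> chain_length S \<le> chain_length T"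
  by (rule chain_length_inj_mono[where h = "\<lambda>X. X"]) (auto simp: inj_on_def)

lemma is_strict_chain_append:
  assumes "is_strict_chain S n N" "N n \<subset> X" "X \<in> S"
  shows "is_strict_chain S (Suc n) (N(Suc n := X))"
  unfolding is_strict_chain_def
proof (intro conjI allI impI)
  fix i assume "i \<le> Suc n"
  then show "(N(Suc n := X)) i \<in> S"
    using assms by (cases "i = Suc n") (auto simp: is_strict_chain_def)
next
  fix i assume "i < Suc n"
  then show "(N(Suc n := X)) i \<subset> (N(Suc n := X)) (Suc i)"
    using assms by (cases "i = n") (auto simp: is_strict_chain_def)
qed

text \<open>Every strict step of a chain in \<open>S\<close> moves \<open>g\<close> or
  \<open>h\<close>, so after deleting repetitions the two image chains together have at least as
  many steps. Injectivity is asked only for nested pairs: a chain sees no others, and this is what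
  the modular law delivers.\<close>

lemma chain_length_le_add:
  assumes g: "\<And>X. X \<in> S \<Longrightarrow> g X \<in> T" and h: "\<And>X. X \<in> S \<Longrightarrow> h X \<in> U"
    and gm: "\<And>X Y. X \<in> S \<Longrightarrow> Y \<in> S \<Longrightarrow> X \<subseteq> Y \<Longrightarrow> g X \<subseteq> g Y"
    and hm: "\<And>X Y. X \<in> S \<Longrightarrow> Y \<in> S \<Longrightarrow> X \<subseteq> Y \<Longrightarrow> h X \<subseteq> h Y"
    and inj: "\<And>X Y. X \<in> S \<Longrightarrow> Y \<in> S \<Longrightarrow> X \<subseteq> Y \<Longrightarrow> g X = g Y \<Longrightarrow> h X = h Y \<Longrightarrow> X = Y"
  shows "chain_length S \<le> chain_length T + chain_length U"
  unfolding chain_length_le_iff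
proof (intro allI impI)
  fix n N assume N: "is_strict_chain S n N"
  \<comment> \<open>The ends of both chains are tied to the images of \<open>N n\<close>, so that
    the next image can be appended whenever it is new.\<close>
  have "\<exists>p q A B. n \<le> p + q \<and> is_strict_chain T p A \<and> A p = g (N n)
      \<and> is_strict_chain U q B \<and> B q = h (N n)"
    using N
  proof (induction n)
    case 0
    then have "is_strict_chain T 0 (\<lambda>_. g (N 0))" "is_strict_chain U 0 (\<lambda>_. h (N 0))"
      using g h by (auto simp: is_strict_chain_def)
    then show ?case by (intro exI[of _ 0]) auto
  next
    case (Suc n)
    then obtain p q A B where IH: "n \<le> p + q" "is_strict_chain T p A" "A p = g (N n)"
      "is_strict_chain U q B" "B q = h (N n)"
      using is_strict_chain_shorten[OF Suc.prems, of n] by auto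
    have NS: "N n \<in> S" "N (Suc n) \<in> S" "N n \<subset> N (Suc n)"
      using Suc.prems by (auto simp: is_strict_chain_def)
    then have sub: "g (N n) \<subseteq> g (N (Suc n))" "h (N n) \<subseteq> h (N (Suc n))"
      using gm hm by auto
    have "\<exists>p' A'. p \<le> p' \<and> (g (N n) \<noteq> g (N (Suc n)) \<longrightarrow> p < p') \<and> is_strict_chain T p' A' \<and> A' p' = g (N (Suc n))"
    proof (cases "g (N n) = g (N (Suc n))")
      case False
      with sub is_strict_chain_append[OF IH(2), of "g (N (Suc n))"] g[OF NS(2)] IH(3) show ?thesis
        by (intro exI[of _ "Suc p"] exI[of _ "A(Suc p := g (N (Suc n)))"]) auto
    qed (use IH in auto)
    moreover have "\<exists>q' B'. q \<le> q' \<and> (h (N n) \<noteq> h (N (Suc n)) \<longrightarrow> q < q') \<and> is_strict_chain U q' B' \<and> B' q' = h (N (Suc n))"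
    proof (cases "h (N n) = h (N (Suc n))")
      case False
      with sub is_strict_chain_append[OF IH(4), of "h (N (Suc n))"] h[OF NS(2)] IH(5) show ?thesis
        by (intro exI[of _ "Suc q"] exI[of _ "B(Suc q := h (N (Suc n)))"]) auto
    qed (use IH in auto)
    ultimately obtain p' A' q' B' where *: "p \<le> p'" "g (N n) \<noteq> g (N (Suc n)) \<longrightarrow> p < p'"
      "is_strict_chain T p' A'" "A' p' = g (N (Suc n))"
      "q \<le> q'" "h (N n) \<noteq> h (N (Suc n)) \<longrightarrow> q < q'" "is_strict_chain U q' B'" "B' q' = h (N (Suc n))"
      by blast
    have "g (N n) \<noteq> g (N (Suc n)) \<or> h (N n) \<noteq> h (N (Suc n))"
      using inj[OF NS(1,2)] NS(3) by blast
    then have "Suc n \<le> p' + q'" using * IH(1) by linarith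
    with * show ?case by blast
  qed
  then obtain p q A B where "n \<le> p + q" "is_strict_chain T p A" "is_strict_chain U q B" by blast
  then show "enat n \<le> chain_length T + chain_length U"
    using add_mono[OF le_chain_length le_chain_length, of T p A U q B]
    by (metis enat_ord_simps(1) order_trans plus_enat_simps(1))
qed

lemma chain_length_add_le:
  assumes T: "\<And>X. X \<in> T \<Longrightarrow> X \<in> S \<and> X \<subseteq> P" and U: "\<And>X. X \<in> U \<Longrightarrow> X \<in> S \<and> P \<subseteq> X"
    and P: "P \<in> T" "P \<in> U"
  shows "chain_length T + chain_length U \<le> chain_length S"
proof -
  have key: "enat p + enat q \<le> chain_length S"
    if p: "enat p \<le> chain_length T" and q: "enat q \<le> chain_length U" for p q
  proof -
    obtain A where A: "is_strict_chain T p A" using enat_le_chain_length_imp[OF p] P by auto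
    obtain B where B: "is_strict_chain U q B" using enat_le_chain_length_imp[OF q] P by auto
    \<comment> \<open>The chains need not end or begin at \<open>P\<close>; replacing both the last
      member of \<open>A\<close> and the first of \<open>B\<close> by \<open>P\<close> glues them
      without losing a step.\<close>
    define N where "N i = (if i < p then A i else if i = p then P else B (i - p))" for i
    have "is_strict_chain S (p + q) N"
      unfolding is_strict_chain_def
    proof (intro conjI allI impI)
      fix i assume "i \<le> p + q"
      then show "N i \<in> S"
        using A B T[OF P(1)] T[of "A i"] U[of "B (i - p)"] by (auto simp: N_def is_strict_chain_def)
    next
      fix i assume i: "i < p + q"
      consider "Suc i < p" | "Suc i = p" | "i = p" | "i > p" by linarith
      then show "N i \<subset> N (Suc i)"
      proof cases
        case 1
        then show ?thesis using A by (auto simp: N_def is_strict_chain_def)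
      next
        case 2
        then have "A i \<subset> A p" "A p \<in> T" using A by (auto simp: is_strict_chain_def)
        then show ?thesis using 2 T by (auto simp: N_def)
      next
        case 3
        then have "B 0 \<subset> B (Suc 0)" "B 0 \<in> U" using B i by (auto simp: is_strict_chain_def)
        then show ?thesis using 3 U by (auto simp: N_def)
      next
        case 4
        then show ?thesis using B i by (auto simp: N_def is_strict_chain_def Suc_diff_le)
      qed
    qed
    then show ?thesis by (simp add: le_chain_length)
  qed
  show ?thesis
  proof (cases "chain_length T")
    case (enat p)
    show ?thesis
    proof (cases "chain_length U")
      case [simp]: (enat q)
      show ?thesis using key[of p q] \<open>chain_length T = enat p\<close> by simp
    next
      case infinity
      then have "enat q \<le> chain_length S" for q
        using key[of 0 q] by (simp add: zero_enat_def[symmetric])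
      then have "chain_length S = \<infinity>"
        by (metis enat_ord_code(4) enat_ord_simps(2) not_enat_eq not_le lessI)
      then show ?thesis by simp
    qed
  next
    case infinity
    then have "enat q \<le> chain_length S" for q
      using key[of q 0] by (simp add: zero_enat_def[symmetric])
    then have "chain_length S = \<infinity>"
      by (metis enat_ord_code(4) enat_ord_simps(2) not_enat_eq not_le lessI)
    then show ?thesis by simp
  qed
qed

section \<open>Relative lengths of submodules\<close>

context module
begin

lemma submodule_iff:
  "submodule N R M \<longleftrightarrow>
    N \<subseteq> carrier M \<and> \<zero>\<^bsub>M\<^esub> \<in> N \<and> (\<forall>x\<in>N. \<forall>y\<in>N. x \<oplus>\<^bsub>M\<^esub> y \<in> N) \<and> (\<forall>a\<in>carrier R. \<forall>x\<in>N. a \<odot>\<^bsub>M\<^esub> x \<in> N)"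
  (is "_ \<longleftrightarrow> ?P")
proof
  assume N: "submodule N R M"
  then have "\<zero>\<^bsub>M\<^esub> \<in> N"
    using submoduleE(2,4)[OF N] submoduleE(1)[OF N] smult_l_null R.zero_closed
    by (metis all_not_in_conv subset_iff)
  with submoduleE[OF N] show ?P by auto
next
  assume N: ?P
  show "submodule N R M"
  proof (rule submoduleI)
    fix x assume "x \<in> N"
    moreover have "\<ominus>\<^bsub>M\<^esub> x = (\<ominus> \<one>) \<odot>\<^bsub>M\<^esub> x" if "x \<in> carrier M" for x
      using that smult_l_minus[of \<one> x] by simp
    ultimately show "\<ominus>\<^bsub>M\<^esub> x \<in> N" using N by auto
  qed (use N in auto)
qed

lemma submodule_simps:
  assumes "submodule N R M"
  shows "\<zero>\<^bsub>M\<^esub> \<in> N"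
    and "x \<in> N \<Longrightarrow> x \<in> carrier M"
    and "x \<in> N \<Longrightarrow> y \<in> N \<Longrightarrow> x \<oplus>\<^bsub>M\<^esub> y \<in> N"
    and "x \<in> N \<Longrightarrow> y \<in> N \<Longrightarrow> x \<ominus>\<^bsub>M\<^esub> y \<in> N"
    and "a \<in> carrier R \<Longrightarrow> x \<in> N \<Longrightarrow> a \<odot>\<^bsub>M\<^esub> x \<in> N"
  using assms submoduleE(3)[OF assms] unfolding submodule_iff by (auto simp: a_minus_def)

lemma submodule_add_cancel_left:
  assumes "submodule N R M" "x \<in> N" "y \<in> carrier M" "x \<oplus>\<^bsub>M\<^esub> y \<in> N"
  shows "y \<in> N"
proof -
  have "x \<in> carrier M" using assms submodule_simps by blast
  then have "y = (x \<oplus>\<^bsub>M\<^esub> y) \<ominus>\<^bsub>M\<^esub> x"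
    using assms(3) by (metis M.add.inv_solve_right' M.add.m_comm M.minus_eq M.add.m_closed)
  with assms submodule_simps(4)[OF assms(1), of "x \<oplus>\<^bsub>M\<^esub> y" x] show ?thesis by simp
qed

lemma submodule_add_cancel_right:
  assumes "submodule N R M" "y \<in> N" "x \<in> carrier M" "x \<oplus>\<^bsub>M\<^esub> y \<in> N"
  shows "x \<in> N"
  using submodule_add_cancel_left[of N y x] assms submodule_simps(2)[OF assms(1,2)] M.a_comm by auto

lemma mem_set_add_iff: "z \<in> A <+>\<^bsub>M\<^esub> B \<longleftrightarrow> (\<exists>x\<in>A. \<exists>y\<in>B. z = x \<oplus>\<^bsub>M\<^esub> y)"
  by (auto simp: set_add_def')

lemma set_addI: "x \<in> A \<Longrightarrow> y \<in> B \<Longrightarrow> x \<oplus>\<^bsub>M\<^esub> y \<in> A <+>\<^bsub>M\<^esub> B"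
  by (auto simp: mem_set_add_iff)

lemma set_add_mono: "A \<subseteq> A' \<Longrightarrow> B \<subseteq> B' \<Longrightarrow> A <+>\<^bsub>M\<^esub> B \<subseteq> A' <+>\<^bsub>M\<^esub> B'"
  unfolding mem_set_add_iff subset_iff by blast

lemma set_add_commute:
  assumes "submodule A R M" "submodule B R M"
  shows "A <+>\<^bsub>M\<^esub> B = B <+>\<^bsub>M\<^esub> A"
  unfolding set_eq_iff mem_set_add_iff
  using M.a_comm submodule_simps(2)[OF assms(1)] submodule_simps(2)[OF assms(2)] by metis

lemma submodule_zero: "submodule {\<zero>\<^bsub>M\<^esub>} R M"
  by (simp add: submodule_iff)

lemma submodule_Int:
  "submodule A R M \<Longrightarrow> submodule B R M \<Longrightarrow> submodule (A \<inter> B) R M"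
  unfolding submodule_iff by blast

lemma submodule_set_add:
  assumes "submodule A R M" "submodule B R M"
  shows "submodule (A <+>\<^bsub>M\<^esub> B) R M"
proof -
  note A = submodule_simps[OF assms(1)] and B = submodule_simps[OF assms(2)]
  have "A <+>\<^bsub>M\<^esub> B \<subseteq> carrier M"
    using A(2) B(2) by (auto simp: mem_set_add_iff)
  moreover have "\<zero>\<^bsub>M\<^esub> \<in> A <+>\<^bsub>M\<^esub> B"
    unfolding mem_set_add_iff using A(1) B(1) M.l_zero[OF M.zero_closed] by force
  moreover have "x \<oplus>\<^bsub>M\<^esub> y \<in> A <+>\<^bsub>M\<^esub> B" if xy: "x \<in> A <+>\<^bsub>M\<^esub> B" "y \<in> A <+>\<^bsub>M\<^esub> B" for x y
  proof -
    obtain a b a' b' where "a \<in> A" "b \<in> B" "a' \<in> A" "b' \<in> B"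
      and [simp]: "x = a \<oplus>\<^bsub>M\<^esub> b" "y = a' \<oplus>\<^bsub>M\<^esub> b'"
      using xy unfolding mem_set_add_iff by blast
    moreover from this have "x \<oplus>\<^bsub>M\<^esub> y = (a \<oplus>\<^bsub>M\<^esub> a') \<oplus>\<^bsub>M\<^esub> (b \<oplus>\<^bsub>M\<^esub> b')"
      using A(2) B(2) by (simp add: M.add.m_ac)
    ultimately show ?thesis unfolding mem_set_add_iff using A(3) B(3) by blast
  qed
  moreover have "c \<odot>\<^bsub>M\<^esub> x \<in> A <+>\<^bsub>M\<^esub> B" if c: "c \<in> carrier R" "x \<in> A <+>\<^bsub>M\<^esub> B" for c x
  proof -
    obtain a b where "a \<in> A" "b \<in> B" and [simp]: "x = a \<oplus>\<^bsub>M\<^esub> b"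
      using c(2) unfolding mem_set_add_iff by blast
    moreover from this have "c \<odot>\<^bsub>M\<^esub> x = (c \<odot>\<^bsub>M\<^esub> a) \<oplus>\<^bsub>M\<^esub> (c \<odot>\<^bsub>M\<^esub> b)"
      using A(2) B(2) c by (simp add: smult_r_distr)
    ultimately show ?thesis unfolding mem_set_add_iff using A(5) B(5) c(1) by blast
  qed
  ultimately show ?thesis unfolding submodule_iff by blast
qed

lemma subset_set_add:
  assumes "submodule A R M" "submodule B R M"
  shows "A \<subseteq> A <+>\<^bsub>M\<^esub> B" "B \<subseteq> A <+>\<^bsub>M\<^esub> B"
proof -
  note A = submodule_simps[OF assms(1)] and B = submodule_simps[OF assms(2)]
  show "A \<subseteq> A <+>\<^bsub>M\<^esub> B"
  proof
    fix x assume "x \<in> A"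
    then show "x \<in> A <+>\<^bsub>M\<^esub> B"
      unfolding mem_set_add_iff using A(2) B(1) by (metis M.r_zero)
  qed
  show "B \<subseteq> A <+>\<^bsub>M\<^esub> B"
  proof
    fix x assume "x \<in> B"
    then show "x \<in> A <+>\<^bsub>M\<^esub> B"
      unfolding mem_set_add_iff using B(2) A(1) by (metis M.l_zero)
  qed
qed

lemma set_add_subset_iff:
  assumes "submodule A R M" "submodule B R M" "submodule C R M"
  shows "A <+>\<^bsub>M\<^esub> B \<subseteq> C \<longleftrightarrow> A \<subseteq> C \<and> B \<subseteq> C"
  using subset_set_add[OF assms(1,2)] submodule_simps(3)[OF assms(3)]
  by (auto simp: mem_set_add_iff subset_iff)

lemma modular_law:
  assumes "submodule A R M" "submodule B R M" "submodule C R M" "A \<subseteq> C"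
  shows "(A <+>\<^bsub>M\<^esub> B) \<inter> C = A <+>\<^bsub>M\<^esub> (B \<inter> C)"
proof
  show "(A <+>\<^bsub>M\<^esub> B) \<inter> C \<subseteq> A <+>\<^bsub>M\<^esub> (B \<inter> C)"
  proof
    fix x assume x: "x \<in> (A <+>\<^bsub>M\<^esub> B) \<inter> C"
    then obtain a b where ab: "a \<in> A" "b \<in> B" "x = a \<oplus>\<^bsub>M\<^esub> b" by (auto simp: mem_set_add_iff)
    then have "b \<in> C"
      using submodule_add_cancel_left[OF assms(3), of a b] x assms(4) submodule_simps(2)[OF assms(2)] by auto
    with ab show "x \<in> A <+>\<^bsub>M\<^esub> (B \<inter> C)" by (auto simp: mem_set_add_iff)
  qed
  show "A <+>\<^bsub>M\<^esub> (B \<inter> C) \<subseteq> (A <+>\<^bsub>M\<^esub> B) \<inter> C"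
    using set_add_mono[of A A "B \<inter> C" B] assms set_add_subset_iff[of A "B \<inter> C" C] submodule_Int by auto
qed

text \<open>This is the length of \<open>L / N\<close>, read off from the interval of submodules
  between \<open>N\<close> and \<open>L\<close>.\<close>

definition rel_length :: "'c set \<Rightarrow> 'c set \<Rightarrow> enat" where
  "rel_length N L = chain_length {Q. submodule Q R M \<and> N \<subseteq> Q \<and> Q \<subseteq> L}"

lemma rel_length_mono: "L \<subseteq> L' \<Longrightarrow> rel_length N L \<le> rel_length N L'"
  unfolding rel_length_def by (rule chain_length_mono) auto

text \<open>For nested submodules with the same intersection with \<open>P\<close> and the same sum
  with \<open>P\<close>, the modular law forces equality; this bounds the left side. Concatenating
  chains at \<open>P\<close> gives the other direction.\<close>

lemma rel_length_add:
  assumes "submodule N R M" "submodule P R M" "submodule L R M" "N \<subseteq> P" "P \<subseteq> L"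
  shows "rel_length N L = rel_length N P + rel_length P L"
proof (rule antisym)
  show "rel_length N L \<le> rel_length N P + rel_length P L"
    unfolding rel_length_def
  proof (rule chain_length_le_add[where g = "\<lambda>Q. Q \<inter> P" and h = "\<lambda>Q. P <+>\<^bsub>M\<^esub> Q"])
    fix X assume X: "X \<in> {Q. submodule Q R M \<and> N \<subseteq> Q \<and> Q \<subseteq> L}"
    then show "X \<inter> P \<in> {Q. submodule Q R M \<and> N \<subseteq> Q \<and> Q \<subseteq> P}"
      using assms submodule_Int by auto
    show "P <+>\<^bsub>M\<^esub> X \<in> {Q. submodule Q R M \<and> P \<subseteq> Q \<and> Q \<subseteq> L}"
      using X assms submodule_set_add[of P X] subset_set_add(1)[of P X] set_add_subset_iff[of P X L] by auto
  next
    fix X Y assume X: "X \<in> {Q. submodule Q R M \<and> N \<subseteq> Q \<and> Q \<subseteq> L}"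
      and Y: "Y \<in> {Q. submodule Q R M \<and> N \<subseteq> Q \<and> Q \<subseteq> L}"
      and XY: "X \<subseteq> Y"
    from XY show "X \<inter> P \<subseteq> Y \<inter> P" "P <+>\<^bsub>M\<^esub> X \<subseteq> P <+>\<^bsub>M\<^esub> Y"
      by (auto intro: set_add_mono[THEN subsetD])
    assume eq: "X \<inter> P = Y \<inter> P" "P <+>\<^bsub>M\<^esub> X = P <+>\<^bsub>M\<^esub> Y"
    have comm: "P <+>\<^bsub>M\<^esub> X = X <+>\<^bsub>M\<^esub> P"
      using set_add_commute[of P X] assms(2) X by auto
    have "Y = (X <+>\<^bsub>M\<^esub> P) \<inter> Y"
      using eq(2) comm subset_set_add(2)[OF assms(2), of Y] Y by auto
    also have "\<dots> = X <+>\<^bsub>M\<^esub> (P \<inter> Y)"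
      using modular_law[of X P Y] X Y XY assms(2) by auto
    also have "P \<inter> Y = P \<inter> X" using eq(1) by blast
    also have "X <+>\<^bsub>M\<^esub> (P \<inter> X) \<subseteq> X"
      using X submodule_simps(3) by (auto simp: mem_set_add_iff)
    finally show "X = Y" using XY by blast
  qed
  show "rel_length N P + rel_length P L \<le> rel_length N L"
    unfolding rel_length_def by (rule chain_length_add_le[where P = P]) (use assms in auto)
qed

text \<open>The maps \<open>Q \<mapsto> Q \<inter> P\<close> and \<open>Q \<mapsto> N + Q\<close>
  are mutually inverse between the two intervals by the modular law, which is the second isomorphism
  theorem on the level of lattices.\<close>

lemma rel_length_second_iso:
  assumes "submodule N R M" "submodule P R M"
  shows "rel_length N (N <+>\<^bsub>M\<^esub> P) = rel_length (N \<inter> P) P"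
proof (rule antisym)
  show "rel_length N (N <+>\<^bsub>M\<^esub> P) \<le> rel_length (N \<inter> P) P"
    unfolding rel_length_def
  proof (rule chain_length_inj_mono[where h = "\<lambda>Q. Q \<inter> P"])
    show "inj_on (\<lambda>Q. Q \<inter> P) {Q. submodule Q R M \<and> N \<subseteq> Q \<and> Q \<subseteq> N <+>\<^bsub>M\<^esub> P}"
    proof (rule inj_on_inverseI[where g = "\<lambda>Q. N <+>\<^bsub>M\<^esub> Q"])
      fix Q assume "Q \<in> {Q. submodule Q R M \<and> N \<subseteq> Q \<and> Q \<subseteq> N <+>\<^bsub>M\<^esub> P}"
      then show "N <+>\<^bsub>M\<^esub> (Q \<inter> P) = Q"
        using modular_law[of N P Q] assms by (auto simp: Int_commute)
    qed
  qed (use assms submodule_Int in auto)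
  show "rel_length (N \<inter> P) P \<le> rel_length N (N <+>\<^bsub>M\<^esub> P)"
    unfolding rel_length_def
  proof (rule chain_length_inj_mono[where h = "\<lambda>Q. N <+>\<^bsub>M\<^esub> Q"])
    show "inj_on (\<lambda>Q. N <+>\<^bsub>M\<^esub> Q) {Q. submodule Q R M \<and> N \<inter> P \<subseteq> Q \<and> Q \<subseteq> P}"
    proof (rule inj_on_inverseI[where g = "\<lambda>Q. Q \<inter> P"])
      fix Q assume Q: "Q \<in> {Q. submodule Q R M \<and> N \<inter> P \<subseteq> Q \<and> Q \<subseteq> P}"
      have "N <+>\<^bsub>M\<^esub> Q = Q <+>\<^bsub>M\<^esub> N"
        using set_add_commute[of N Q] assms(1) Q by auto
      then have "(N <+>\<^bsub>M\<^esub> Q) \<inter> P = Q <+>\<^bsub>M\<^esub> (N \<inter> P)"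
        using modular_law[of Q N P] Q assms by auto
      also have "\<dots> = Q"
        using Q set_add_subset_iff[of Q "N \<inter> P" Q] subset_set_add(1)[of Q "N \<inter> P"]
          submodule_Int[OF assms] by auto
      finally show "(N <+>\<^bsub>M\<^esub> Q) \<inter> P = Q" .
    qed
  next
    fix X assume X: "X \<in> {Q. submodule Q R M \<and> N \<inter> P \<subseteq> Q \<and> Q \<subseteq> P}"
    then show "N <+>\<^bsub>M\<^esub> X \<in> {Q. submodule Q R M \<and> N \<subseteq> Q \<and> Q \<subseteq> N <+>\<^bsub>M\<^esub> P}"
      using submodule_set_add[of N X] subset_set_add(1)[of N X] assms set_add_mono[of N N X P] by auto
  qed (auto intro: set_add_mono[THEN subsetD])
qed

lemma submodule_restrict_iff:
  assumes "submodule L R M"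
  shows "submodule N R (M\<lparr>carrier := L\<rparr>) \<longleftrightarrow> submodule N R M \<and> N \<subseteq> L"
proof -
  interpret L: module R "M\<lparr>carrier := L\<rparr>"
    using submodule.submodule_is_module[OF assms module_axioms] .
  show ?thesis
    unfolding submodule_iff L.submodule_iff using submodule_simps(2)[OF assms] by auto
qed

lemma module_length_restrict:
  assumes "submodule L R M"
  shows "module_length R (M\<lparr>carrier := L\<rparr>) = rel_length {\<zero>\<^bsub>M\<^esub>} L"
proof -
  have "{N. submodule N R (M\<lparr>carrier := L\<rparr>)} = {Q. submodule Q R M \<and> {\<zero>\<^bsub>M\<^esub>} \<subseteq> Q \<and> Q \<subseteq> L}"
    using submodule_restrict_iff[OF assms] by (auto simp: submodule_iff)
  then show ?thesis by (simp add: module_length_eq_chain_length rel_length_def)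
qed

end

section \<open>Lengths of quotient modules\<close>

context module
begin

lemma abelian_subgroup_if_submodule:
  assumes "submodule N R M"
  shows "abelian_subgroup N M"
  using assms M.abelian_group_axioms
  by (intro abelian_subgroupI3) (auto simp: additive_subgroup_def submodule_def)

text \<open>Since \<open>a N \<subseteq> N\<close>, the cosets united in the scalar multiplication
  of \<open>quotient_module\<close> all coincide.\<close>

lemma smult_coset:
  assumes "submodule N R M" "a \<in> carrier R" "x \<in> carrier M"
  shows "(\<Union>y\<in>N +>\<^bsub>M\<^esub> x. N +>\<^bsub>M\<^esub> (a \<odot>\<^bsub>M\<^esub> y)) = N +>\<^bsub>M\<^esub> (a \<odot>\<^bsub>M\<^esub> x)"
proof -
  interpret N: abelian_subgroup N M using abelian_subgroup_if_submodule[OF assms(1)] .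
  have "N +>\<^bsub>M\<^esub> (a \<odot>\<^bsub>M\<^esub> y) = N +>\<^bsub>M\<^esub> (a \<odot>\<^bsub>M\<^esub> x)" if y: "y \<in> N +>\<^bsub>M\<^esub> x" for y
  proof -
    obtain n where n: "n \<in> N" "y = n \<oplus>\<^bsub>M\<^esub> x" using y by (auto simp: a_r_coset_def')
    then have "a \<odot>\<^bsub>M\<^esub> y = (a \<odot>\<^bsub>M\<^esub> n) \<oplus>\<^bsub>M\<^esub> (a \<odot>\<^bsub>M\<^esub> x)" "a \<odot>\<^bsub>M\<^esub> n \<in> N"
      using assms submodule_simps[OF assms(1)] by (auto simp: smult_r_distr)
    then have "a \<odot>\<^bsub>M\<^esub> y \<in> N +>\<^bsub>M\<^esub> (a \<odot>\<^bsub>M\<^esub> x)" by (auto simp: a_r_coset_def')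
    then show ?thesis using assms by (metis N.a_repr_independence' smult_closed)
  qed
  moreover have "x \<in> N +>\<^bsub>M\<^esub> x" using assms(3) by (rule N.a_rcos_self)
  ultimately show ?thesis by blast
qed

lemma mem_carrier_quotient_module_iff:
  "X \<in> carrier (quotient_module M N) \<longleftrightarrow> (\<exists>x\<in>carrier M. X = N +>\<^bsub>M\<^esub> x)"
  by (auto simp: quotient_module_def A_RCOSETS_def')

lemma quotient_module_add:
  assumes "submodule N R M" "x \<in> carrier M" "y \<in> carrier M"
  shows "(N +>\<^bsub>M\<^esub> x) \<oplus>\<^bsub>quotient_module M N\<^esub> (N +>\<^bsub>M\<^esub> y) = N +>\<^bsub>M\<^esub> (x \<oplus>\<^bsub>M\<^esub> y)"
  using abelian_subgroup.a_rcos_sum[OF abelian_subgroup_if_submodule] assms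
  by (simp add: quotient_module_def)

lemma quotient_module_smult:
  assumes "submodule N R M" "a \<in> carrier R" "x \<in> carrier M"
  shows "a \<odot>\<^bsub>quotient_module M N\<^esub> (N +>\<^bsub>M\<^esub> x) = N +>\<^bsub>M\<^esub> (a \<odot>\<^bsub>M\<^esub> x)"
  using smult_coset[OF assms] by (simp add: quotient_module_def)

lemma module_quotient_module:
  assumes "submodule N R M"
  shows "module R (quotient_module M N)"
proof -
  interpret N: abelian_subgroup N M using abelian_subgroup_if_submodule[OF assms] .
  let ?Q = "quotient_module M N"
  note carr = mem_carrier_quotient_module_iff[of _ N] and add = quotient_module_add[OF assms]
    and smult = quotient_module_smult[OF assms]
  have zero: "\<zero>\<^bsub>?Q\<^esub> = N +>\<^bsub>M\<^esub> \<zero>\<^bsub>M\<^esub>"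
    using N.a_rcos_const submodule_simps(1)[OF assms] by (simp add: quotient_module_def)
  have ab: "abelian_group ?Q"
  proof (rule abelian_groupI)
    fix X Y assume "X \<in> carrier ?Q" "Y \<in> carrier ?Q"
    then obtain x y where x: "x \<in> carrier M" "y \<in> carrier M"
      and [simp]: "X = N +>\<^bsub>M\<^esub> x" "Y = N +>\<^bsub>M\<^esub> y" unfolding carr by blast
    show "X \<oplus>\<^bsub>?Q\<^esub> Y \<in> carrier ?Q" unfolding carr using add[OF x] x M.a_closed by auto
    show "X \<oplus>\<^bsub>?Q\<^esub> Y = Y \<oplus>\<^bsub>?Q\<^esub> X" using x by (simp add: add M.a_comm)
    fix Z assume "Z \<in> carrier ?Q"
    then obtain z where "z \<in> carrier M" and [simp]: "Z = N +>\<^bsub>M\<^esub> z" unfolding carr by blast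
    then show "X \<oplus>\<^bsub>?Q\<^esub> Y \<oplus>\<^bsub>?Q\<^esub> Z = X \<oplus>\<^bsub>?Q\<^esub> (Y \<oplus>\<^bsub>?Q\<^esub> Z)" using x by (simp add: add M.a_assoc)
  next
    show "\<zero>\<^bsub>?Q\<^esub> \<in> carrier ?Q" using zero carr by auto
  next
    fix X assume "X \<in> carrier ?Q"
    then obtain x where x: "x \<in> carrier M" and [simp]: "X = N +>\<^bsub>M\<^esub> x" unfolding carr by blast
    show "\<zero>\<^bsub>?Q\<^esub> \<oplus>\<^bsub>?Q\<^esub> X = X" using x by (simp add: add zero)
    have "(N +>\<^bsub>M\<^esub> (\<ominus>\<^bsub>M\<^esub> x)) \<oplus>\<^bsub>?Q\<^esub> X = \<zero>\<^bsub>?Q\<^esub>" using x by (simp add: add zero M.l_neg)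
    moreover have "N +>\<^bsub>M\<^esub> (\<ominus>\<^bsub>M\<^esub> x) \<in> carrier ?Q" unfolding carr using x by auto
    ultimately show "\<exists>Y\<in>carrier ?Q. Y \<oplus>\<^bsub>?Q\<^esub> X = \<zero>\<^bsub>?Q\<^esub>" by blast
  qed
  show ?thesis
  proof (rule moduleI)
    show "abelian_group ?Q" by (rule ab)
    show "cring R" by (rule R.is_cring)
  next
    fix a X assume a: "a \<in> carrier R" and "X \<in> carrier ?Q"
    then obtain x where x: "x \<in> carrier M" and [simp]: "X = N +>\<^bsub>M\<^esub> x" unfolding carr by blast
    show "a \<odot>\<^bsub>?Q\<^esub> X \<in> carrier ?Q"
      using smult[OF a x] smult_closed[OF a x] carr by auto
  next
    fix a b X assume a: "a \<in> carrier R" "b \<in> carrier R" and "X \<in> carrier ?Q"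
    then obtain x where x: "x \<in> carrier M" and [simp]: "X = N +>\<^bsub>M\<^esub> x" unfolding carr by blast
    show "(a \<oplus> b) \<odot>\<^bsub>?Q\<^esub> X = a \<odot>\<^bsub>?Q\<^esub> X \<oplus>\<^bsub>?Q\<^esub> b \<odot>\<^bsub>?Q\<^esub> X"
      using a x by (simp add: add smult smult_l_distr)
    show "(a \<otimes> b) \<odot>\<^bsub>?Q\<^esub> X = a \<odot>\<^bsub>?Q\<^esub> (b \<odot>\<^bsub>?Q\<^esub> X)"
      using a x by (simp add: smult smult_assoc1)
  next
    fix a X Y assume a: "a \<in> carrier R" and "X \<in> carrier ?Q" "Y \<in> carrier ?Q"
    then obtain x y where x: "x \<in> carrier M" "y \<in> carrier M"
      and [simp]: "X = N +>\<^bsub>M\<^esub> x" "Y = N +>\<^bsub>M\<^esub> y" unfolding carr by blast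
    show "a \<odot>\<^bsub>?Q\<^esub> (X \<oplus>\<^bsub>?Q\<^esub> Y) = a \<odot>\<^bsub>?Q\<^esub> X \<oplus>\<^bsub>?Q\<^esub> a \<odot>\<^bsub>?Q\<^esub> Y"
      using a x by (simp add: add smult smult_r_distr)
  next
    fix X assume "X \<in> carrier ?Q"
    then obtain x where x: "x \<in> carrier M" and [simp]: "X = N +>\<^bsub>M\<^esub> x" unfolding carr by blast
    show "\<one> \<odot>\<^bsub>?Q\<^esub> X = X"
      using x by (simp add: smult)
  qed
qed

text \<open>The correspondence theorem: elements of \<open>M / N\<close> are sets, so the preimage
  of a submodule is simply its union, and the map in the other direction collects cosets. Each map
  is monotone and injective, which yields one inequality each.\<close>

lemma module_length_quotient_eq_chain_length:
  assumes N: "submodule N R M"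
  shows "module_length R (quotient_module M N) = chain_length {P. submodule P R M \<and> N \<subseteq> P}"
proof -
  interpret N: abelian_subgroup N M using abelian_subgroup_if_submodule[OF N] .
  let ?Q = "quotient_module M N"
  interpret Q: module R ?Q using module_quotient_module[OF N] .
  note carr = mem_carrier_quotient_module_iff[of _ N] and add = quotient_module_add[OF N]
    and smult = quotient_module_smult[OF N]
  have zero: "\<zero>\<^bsub>?Q\<^esub> = N" by (simp add: quotient_module_def)
  have coset_eq: "N +>\<^bsub>M\<^esub> x = N +>\<^bsub>M\<^esub> y" if "y \<in> N +>\<^bsub>M\<^esub> x" "x \<in> carrier M" for x y
    using N.a_repr_independence'[OF that] .
  have mem_coset: "z \<in> N +>\<^bsub>M\<^esub> x \<Longrightarrow> \<exists>n\<in>N. z = n \<oplus>\<^bsub>M\<^esub> x" for x z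
    by (auto simp: a_r_coset_def')
  have zero_coset: "N +>\<^bsub>M\<^esub> x = N" if "x \<in> N" for x
    using that N.a_rcos_const by simp
  let ?im = "\<lambda>P. {N +>\<^bsub>M\<^esub> x | x. x \<in> P}"
  have mem_im: "N +>\<^bsub>M\<^esub> x \<in> ?im P \<longleftrightarrow> x \<in> P"
    if P: "submodule P R M" "N \<subseteq> P" and x: "x \<in> carrier M" for P x
  proof
    assume "N +>\<^bsub>M\<^esub> x \<in> ?im P"
    then obtain y where y: "y \<in> P" "N +>\<^bsub>M\<^esub> x = N +>\<^bsub>M\<^esub> y" by blast
    then have "x \<in> N +>\<^bsub>M\<^esub> y" using N.a_rcos_self[OF x] by simp
    then obtain n where "n \<in> N" "x = n \<oplus>\<^bsub>M\<^esub> y" using mem_coset by blast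
    then show "x \<in> P" using P y(1) submodule_simps(3)[OF P(1)] by blast
  qed blast
  have mem_Union: "x \<in> \<Union>X \<longleftrightarrow> N +>\<^bsub>M\<^esub> x \<in> X" if X: "X \<subseteq> carrier ?Q" and x: "x \<in> carrier M" for X x
  proof
    assume "x \<in> \<Union>X"
    then obtain Y where Y: "Y \<in> X" "x \<in> Y" by blast
    then obtain y where "y \<in> carrier M" "Y = N +>\<^bsub>M\<^esub> y" using X carr by blast
    with Y coset_eq[of x y] show "N +>\<^bsub>M\<^esub> x \<in> X" by simp
  next
    assume "N +>\<^bsub>M\<^esub> x \<in> X"
    then show "x \<in> \<Union>X" using N.a_rcos_self[OF x] by blast
  qed
  have Union_carr: "\<Union>X \<subseteq> carrier M" if "X \<subseteq> carrier ?Q" for X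
    using that unfolding subset_iff carr by (metis N.a_elemrcos_carrier UnionE)
  show ?thesis
    unfolding module_length_eq_chain_length
  proof (rule antisym)
    show "chain_length {P. submodule P R ?Q} \<le> chain_length {P. submodule P R M \<and> N \<subseteq> P}"
    proof (rule chain_length_inj_mono[where h = Union])
      fix X assume "X \<in> {P. submodule P R ?Q}"
      then have X: "submodule X R ?Q" by simp
      have Xc: "X \<subseteq> carrier ?Q" using X by (simp add: Q.submodule_iff)
      note mU = mem_Union[OF Xc]
      have "N \<subseteq> \<Union>X"
        using X unfolding Q.submodule_iff zero by blast
      moreover have "submodule (\<Union>X) R M"
        unfolding submodule_iff
      proof (intro conjI ballI)
        show "\<Union>X \<subseteq> carrier M" using Union_carr[OF Xc] .
        show "\<zero>\<^bsub>M\<^esub> \<in> \<Union>X" using \<open>N \<subseteq> \<Union>X\<close> submodule_simps(1)[OF N] by blast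
      next
        fix x y assume xy: "x \<in> \<Union>X" "y \<in> \<Union>X"
        then have c: "x \<in> carrier M" "y \<in> carrier M" using Union_carr[OF Xc] by auto
        have "(N +>\<^bsub>M\<^esub> x) \<oplus>\<^bsub>?Q\<^esub> (N +>\<^bsub>M\<^esub> y) \<in> X"
          using xy Q.submodule_simps(3)[OF X] unfolding mU[OF c(1)] mU[OF c(2)] by blast
        then show "x \<oplus>\<^bsub>M\<^esub> y \<in> \<Union>X" using mU[of "x \<oplus>\<^bsub>M\<^esub> y"] add[OF c] c by simp
      next
        fix a x assume a: "a \<in> carrier R" and x: "x \<in> \<Union>X"
        then have c: "x \<in> carrier M" using Union_carr[OF Xc] by auto
        have "a \<odot>\<^bsub>?Q\<^esub> (N +>\<^bsub>M\<^esub> x) \<in> X"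
          using x a Q.submodule_simps(5)[OF X] unfolding mU[OF c(1)] by blast
        then show "a \<odot>\<^bsub>M\<^esub> x \<in> \<Union>X" using mU[of "a \<odot>\<^bsub>M\<^esub> x"] smult[OF a c] c a by simp
      qed
      ultimately show "\<Union>X \<in> {P. submodule P R M \<and> N \<subseteq> P}" by simp
    next
      show "inj_on Union {P. submodule P R ?Q}"
      proof (rule inj_onI)
        fix X Y assume "X \<in> {P. submodule P R ?Q}" "Y \<in> {P. submodule P R ?Q}" and eq: "\<Union>X = \<Union>Y"
        then have X: "X \<subseteq> carrier ?Q" and Y: "Y \<subseteq> carrier ?Q" by (auto simp: Q.submodule_iff)
        have "N +>\<^bsub>M\<^esub> x \<in> X \<longleftrightarrow> N +>\<^bsub>M\<^esub> x \<in> Y" if "x \<in> carrier M" for x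
          using mem_Union[OF X that] mem_Union[OF Y that] eq by simp
        then have "Z \<in> X \<longleftrightarrow> Z \<in> Y" if "Z \<in> carrier ?Q" for Z using that unfolding carr by auto
        then show "X = Y" using X Y by blast
      qed
    qed blast
    show "chain_length {P. submodule P R M \<and> N \<subseteq> P} \<le> chain_length {P. submodule P R ?Q}"
    proof (rule chain_length_inj_mono[where h = ?im])
      fix P assume "P \<in> {P. submodule P R M \<and> N \<subseteq> P}"
      then have P: "submodule P R M" "N \<subseteq> P" by auto
      note Ps = submodule_simps[OF P(1)]
      have "submodule (?im P) R ?Q"
        unfolding Q.submodule_iff
      proof (intro conjI ballI)
        show "?im P \<subseteq> carrier ?Q" using Ps(2) carr by blast
        show "\<zero>\<^bsub>?Q\<^esub> \<in> ?im P"
          using zero_coset[of "\<zero>\<^bsub>M\<^esub>"] submodule_simps(1)[OF N] Ps(1) zero by blast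
      next
        fix X Y assume "X \<in> ?im P" "Y \<in> ?im P"
        then obtain x y where "x \<in> P" "y \<in> P" "X = N +>\<^bsub>M\<^esub> x" "Y = N +>\<^bsub>M\<^esub> y" by blast
        then show "X \<oplus>\<^bsub>?Q\<^esub> Y \<in> ?im P" using Ps add[of x y] by auto
      next
        fix a X assume a: "a \<in> carrier R" and "X \<in> ?im P"
        then obtain x where "x \<in> P" "X = N +>\<^bsub>M\<^esub> x" by blast
        then show "a \<odot>\<^bsub>?Q\<^esub> X \<in> ?im P" using Ps smult[of a x] a by auto
      qed
      then show "?im P \<in> {P. submodule P R ?Q}" by simp
    next
      show "inj_on ?im {P. submodule P R M \<and> N \<subseteq> P}"
      proof (rule inj_onI)
        fix A B assume "A \<in> {P. submodule P R M \<and> N \<subseteq> P}" "B \<in> {P. submodule P R M \<and> N \<subseteq> P}"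
          and eq: "?im A = ?im B"
        then have A: "submodule A R M" "N \<subseteq> A" and B: "submodule B R M" "N \<subseteq> B" by auto
        have "x \<in> A \<longleftrightarrow> x \<in> B" if "x \<in> carrier M" for x
          using mem_im[OF A that] mem_im[OF B that] unfolding eq by simp
        then show "A = B" using A(1) B(1) submodule_simps(2) by blast
      qed
    qed blast
  qed
qed

lemma module_length_quotient:
  assumes "submodule N R M"
  shows "module_length R (quotient_module M N) = rel_length N (carrier M)"
proof -
  have "{P. submodule P R M \<and> N \<subseteq> P} = {Q. submodule Q R M \<and> N \<subseteq> Q \<and> Q \<subseteq> carrier M}"
    by (auto simp: submodule_iff)
  then show ?thesis
    by (simp add: module_length_quotient_eq_chain_length[OF assms] rel_length_def)
qed

lemma module_length_subquotient:
  assumes "submodule N R M" "submodule L R M" "N \<subseteq> L"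
  shows "module_length R (subquotient_module M L N) = rel_length N L"
proof -
  interpret L: module R "M\<lparr>carrier := L\<rparr>"
    using submodule.submodule_is_module[OF assms(2) module_axioms] .
  have "submodule N R (M\<lparr>carrier := L\<rparr>)"
    using assms by (simp add: submodule_restrict_iff)
  from L.module_length_quotient_eq_chain_length[OF this] show ?thesis
    by (simp add: rel_length_def submodule_restrict_iff[OF assms(2)] conj_ac)
qed

end

section \<open>Ideal powers and Noetherian modules\<close>

text \<open>Stated for arbitrary orders, because it is applied to ideals and submodules under
  inclusion as well as to families of submodules under the pointwise order.\<close>

definition acc_on :: "'x::order set \<Rightarrow> bool" where
  "acc_on S \<longleftrightarrow> (\<forall>C :: nat \<Rightarrow> 'x. mono C \<and> range C \<subseteq> S \<longrightarrow> (\<exists>k. \<forall>i\<ge>k. C i = C k))"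

lemma acc_onD:
  fixes C :: "nat \<Rightarrow> 'x::order"
  assumes "acc_on S" "mono C" "\<And>i. C i \<in> S"
  obtains k where "\<And>i. k \<le> i \<Longrightarrow> C i = C k"
proof -
  have "range C \<subseteq> S" using assms(3) by blast
  then have "\<exists>k. \<forall>i\<ge>k. C i = C k" using assms(1,2) unfolding acc_on_def by simp
  then show ?thesis using that by blast
qed

lemma (in noetherian_ring) acc_on_ideals: "acc_on {J. ideal J R}"
  unfolding acc_on_def
proof (intro allI impI)
  fix C :: "nat \<Rightarrow> 'a set" assume C: "mono C \<and> range C \<subseteq> {J. ideal J R}"
  then have "subset.chain {J. ideal J R} (range C)"
    unfolding subset_chain_def using linear[where 'a = nat] by (auto simp: mono_def) blast
  then have "\<Union>(range C) \<in> range C"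
    by (intro ideal_chain_is_trivial) auto
  then obtain k where k: "\<Union>(range C) = C k" by blast
  have "C i = C k" if "k \<le> i" for i
    using k C that by (auto simp: mono_def)
  then show "\<exists>k. \<forall>i\<ge>k. C i = C k" by blast
qed

section \<open>Products of ideals with submodules, and the filtration by ideal powers\<close>

context module
begin

lemma ideal_smult_subset_iff:
  assumes "submodule L R M"
  shows "ideal_smult M J N \<subseteq> L \<longleftrightarrow> (\<forall>a\<in>J. \<forall>x\<in>N. a \<odot>\<^bsub>M\<^esub> x \<in> L)"
proof
  assume *: "\<forall>a\<in>J. \<forall>x\<in>N. a \<odot>\<^bsub>M\<^esub> x \<in> L"
  show "ideal_smult M J N \<subseteq> L"
  proof
    fix x assume "x \<in> ideal_smult M J N"
    then show "x \<in> L"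
      by induction (use * submodule_simps(3)[OF assms] in auto)
  qed
qed (auto intro: ideal_smult.smult)

lemma ideal_smult_mono: "J \<subseteq> J' \<Longrightarrow> N \<subseteq> N' \<Longrightarrow> ideal_smult M J N \<subseteq> ideal_smult M J' N'"
proof
  fix x assume "x \<in> ideal_smult M J N" and *: "J \<subseteq> J'" "N \<subseteq> N'"
  from this(1) show "x \<in> ideal_smult M J' N'"
    by induction (use * in \<open>auto intro: ideal_smult.intros\<close>)
qed

lemma submodule_ideal_smult:
  assumes "ideal J R" "submodule N R M"
  shows "submodule (ideal_smult M J N) R M"
proof -
  have J: "a \<in> carrier R" if "a \<in> J" for a using that assms(1) by (rule ideal.Icarr[rotated])
  have sub: "ideal_smult M J N \<subseteq> carrier M"
    using J submodule_simps(2)[OF assms(2)] by (simp add: ideal_smult_subset_iff[OF carrier_is_submodule])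
  have "\<zero>\<^bsub>M\<^esub> = \<zero> \<odot>\<^bsub>M\<^esub> \<zero>\<^bsub>M\<^esub>" by simp
  moreover have "\<zero> \<in> J" using assms(1) by (meson additive_subgroup.zero_closed ideal.axioms(1))
  ultimately have "\<zero>\<^bsub>M\<^esub> \<in> ideal_smult M J N"
    using submodule_simps(1)[OF assms(2)] ideal_smult.smult by metis
  moreover have "r \<odot>\<^bsub>M\<^esub> x \<in> ideal_smult M J N" if r: "r \<in> carrier R" and "x \<in> ideal_smult M J N" for r x
    using that(2)
  proof induction
    case (smult a x)
    then have "r \<odot>\<^bsub>M\<^esub> (a \<odot>\<^bsub>M\<^esub> x) = (r \<otimes> a) \<odot>\<^bsub>M\<^esub> x"
      using r J submodule_simps(2)[OF assms(2)] by (simp add: smult_assoc1)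
    then show ?case
      using smult r assms(1) by (simp add: ideal_smult.smult ideal.I_l_closed)
  next
    case (add x y)
    then have "r \<odot>\<^bsub>M\<^esub> (x \<oplus>\<^bsub>M\<^esub> y) = r \<odot>\<^bsub>M\<^esub> x \<oplus>\<^bsub>M\<^esub> r \<odot>\<^bsub>M\<^esub> y"
      using sub r smult_r_distr by blast
    then show ?case using add by (simp add: ideal_smult.add)
  qed
  ultimately show ?thesis
    unfolding submodule_iff using sub by (simp add: ideal_smult.add)
qed

lemma ideal_smult_prod:
  assumes J: "ideal J R" and K: "ideal K R" and N: "submodule N R M"
  shows "ideal_smult M (J \<cdot> K) N = ideal_smult M J (ideal_smult M K N)"
proof
  note carr = ideal.Icarr[OF J] ideal.Icarr[OF K] submodule_simps(2)[OF N]
  have JK: "ideal (J \<cdot> K) R" using J K by (rule ideal_prod_is_ideal)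
  note KN = submodule_ideal_smult[OF K N]
  note JKN = submodule_ideal_smult[OF J KN] and JK_N = submodule_ideal_smult[OF JK N]
  show "ideal_smult M (J \<cdot> K) N \<subseteq> ideal_smult M J (ideal_smult M K N)"
    unfolding ideal_smult_subset_iff[OF JKN]
  proof (intro ballI)
    fix c x assume "c \<in> J \<cdot> K" and x: "x \<in> N"
    from this(1) show "c \<odot>\<^bsub>M\<^esub> x \<in> ideal_smult M J (ideal_smult M K N)"
    proof induction
      case (prod a b)
      then have "(a \<otimes> b) \<odot>\<^bsub>M\<^esub> x = a \<odot>\<^bsub>M\<^esub> (b \<odot>\<^bsub>M\<^esub> x)" using x carr by (simp add: smult_assoc1)
      then show ?case using x prod by (simp add: ideal_smult.smult)
    next
      case (sum a b)
      then have "a \<in> carrier R" "b \<in> carrier R" using ideal.Icarr[OF JK] by auto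
      then have "(a \<oplus> b) \<odot>\<^bsub>M\<^esub> x = a \<odot>\<^bsub>M\<^esub> x \<oplus>\<^bsub>M\<^esub> b \<odot>\<^bsub>M\<^esub> x" using x carr by (simp add: smult_l_distr)
      then show ?case using sum by (simp add: ideal_smult.add)
    qed
  qed
  show "ideal_smult M J (ideal_smult M K N) \<subseteq> ideal_smult M (J \<cdot> K) N"
    unfolding ideal_smult_subset_iff[OF JK_N]
  proof (intro ballI)
    fix a x assume a: "a \<in> J" and "x \<in> ideal_smult M K N"
    from this(2) show "a \<odot>\<^bsub>M\<^esub> x \<in> ideal_smult M (J \<cdot> K) N"
    proof induction
      case (smult b x)
      then have "a \<odot>\<^bsub>M\<^esub> (b \<odot>\<^bsub>M\<^esub> x) = (a \<otimes> b) \<odot>\<^bsub>M\<^esub> x" using a carr by (simp add: smult_assoc1)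
      then show ?case using a smult by (simp add: ideal_smult.smult ideal_prod.prod)
    next
      case (add x y)
      then have "a \<odot>\<^bsub>M\<^esub> (x \<oplus>\<^bsub>M\<^esub> y) = a \<odot>\<^bsub>M\<^esub> x \<oplus>\<^bsub>M\<^esub> a \<odot>\<^bsub>M\<^esub> y"
        using a carr submodule_simps(2)[OF KN] by (simp add: smult_r_distr)
      then show ?case using add by (simp add: ideal_smult.add)
    qed
  qed
qed

lemma ideals_set_simps:
  "J \<otimes>\<^bsub>ideals_set R\<^esub> K = J \<cdot> K" "\<one>\<^bsub>ideals_set R\<^esub> = carrier R"
  by (simp_all add: ideals_set_def)

lemma ideal_ideals_set_pow:
  assumes "ideal J R"
  shows "ideal (J [^]\<^bsub>ideals_set R\<^esub> (n::nat)) R"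
  by (induction n) (use assms in \<open>simp_all add: ideals_set_simps oneideal ideal_prod_is_ideal\<close>)

lemma ideal_power_module_0: "ideal_power_module R J 0 M = carrier M"
proof
  show "ideal_power_module R J 0 M \<subseteq> carrier M"
    by (simp add: ideal_power_module_def ideals_set_simps ideal_smult_subset_iff[OF carrier_is_submodule])
  show "carrier M \<subseteq> ideal_power_module R J 0 M"
  proof
    fix x assume "x \<in> carrier M"
    then show "x \<in> ideal_power_module R J 0 M"
      using ideal_smult.smult[of \<one> "carrier R" x "carrier M" M]
      by (simp add: ideal_power_module_def ideals_set_simps)
  qed
qed

lemma submodule_ideal_power_module:
  "ideal J R \<Longrightarrow> submodule (ideal_power_module R J n M) R M"
  by (simp add: ideal_power_module_def submodule_ideal_smult ideal_ideals_set_pow carrier_is_submodule)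

lemma ideal_power_module_Suc:
  assumes "ideal J R"
  shows "ideal_power_module R J (Suc n) M = ideal_smult M J (ideal_power_module R J n M)"
  using ideal_smult_prod[OF assms ideal_ideals_set_pow[OF assms] carrier_is_submodule]
    ideal_prod_commute[OF assms ideal_ideals_set_pow[OF assms]]
  by (simp add: ideal_power_module_def ideals_set_simps)

lemma ideal_smult_subset:
  assumes "ideal J R" "submodule N R M"
  shows "ideal_smult M J N \<subseteq> N"
  using ideal.Icarr[OF assms(1)] submodule_simps(5)[OF assms(2)]
  by (simp add: ideal_smult_subset_iff[OF assms(2)])

lemma ideal_power_module_antimono:
  assumes "ideal J R" "m \<le> n"
  shows "ideal_power_module R J n M \<subseteq> ideal_power_module R J m M"
  by (rule lift_Suc_antimono_le[where f = "\<lambda>n. ideal_power_module R J n M", OF _ assms(2)])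
    (simp add: ideal_power_module_Suc assms(1) ideal_smult_subset submodule_ideal_power_module)

lemma ideal_colon_ring:
  assumes "submodule L R M" "N \<subseteq> carrier M"
  shows "ideal (colon_ring R M L N) R"
proof (rule idealI)
  note L = submodule_simps[OF assms(1)]
  show "subgroup (colon_ring R M L N) (add_monoid R)"
  proof (rule R.add.subgroupI)
    show "colon_ring R M L N \<subseteq> carrier R" by (auto simp: colon_ring_def)
    have "\<zero> \<in> colon_ring R M L N"
      using assms(2) L(1) by (auto simp: colon_ring_def subset_iff)
    then show "colon_ring R M L N \<noteq> {}" by blast
  next
    fix a assume "a \<in> colon_ring R M L N"
    then show "\<ominus> a \<in> colon_ring R M L N"
      using assms(2) submoduleE(3)[OF assms(1)] by (auto simp: colon_ring_def subset_iff smult_l_minus)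
  next
    fix a b assume "a \<in> colon_ring R M L N" "b \<in> colon_ring R M L N"
    then show "a \<oplus> b \<in> colon_ring R M L N"
      using assms(2) L(3) by (auto simp: colon_ring_def subset_iff smult_l_distr)
  qed
next
  note L = submodule_simps[OF assms(1)]
  fix a r assume a: "a \<in> colon_ring R M L N" and r: "r \<in> carrier R"
  show ra: "r \<otimes> a \<in> colon_ring R M L N"
    using a r assms(2) L(5) by (auto simp: colon_ring_def subset_iff smult_assoc1)
  moreover have "a \<otimes> r = r \<otimes> a" using a r by (auto simp: colon_ring_def m_comm)
  ultimately show "a \<otimes> r \<in> colon_ring R M L N" by simp
qed (rule ring_axioms)

text \<open>The scalars that send \<open>N\<close> into \<open>L\<close> form an ideal, so a
  condition on generators extends to the generated ideal.\<close>

lemma smult_genideal_closed: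
  assumes "submodule L R M" "N \<subseteq> carrier M" "A \<subseteq> carrier R"
    and "\<And>a x. a \<in> A \<Longrightarrow> x \<in> N \<Longrightarrow> a \<odot>\<^bsub>M\<^esub> x \<in> L"
    and "r \<in> Idl A" "x \<in> N"
  shows "r \<odot>\<^bsub>M\<^esub> x \<in> L"
proof -
  have "Idl A \<subseteq> colon_ring R M L N"
    using assms by (intro genideal_minimal ideal_colon_ring) (auto simp: colon_ring_def)
  then show ?thesis using assms(5,6) by (auto simp: colon_ring_def)
qed

section \<open>Ascending chain condition in finitely generated modules\<close>

lemma submodule_cyclic:
  assumes "x \<in> carrier M"
  shows "submodule ((\<lambda>a. a \<odot>\<^bsub>M\<^esub> x) ` carrier R) R M"
  unfolding submodule_iff
proof (intro conjI ballI)
  show "\<zero>\<^bsub>M\<^esub> \<in> (\<lambda>a. a \<odot>\<^bsub>M\<^esub> x) ` carrier R" using assms by (intro image_eqI[of _ _ \<zero>]) auto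
next
  fix y z assume "y \<in> (\<lambda>a. a \<odot>\<^bsub>M\<^esub> x) ` carrier R" "z \<in> (\<lambda>a. a \<odot>\<^bsub>M\<^esub> x) ` carrier R"
  then obtain a b where "a \<in> carrier R" "b \<in> carrier R" "y = a \<odot>\<^bsub>M\<^esub> x" "z = b \<odot>\<^bsub>M\<^esub> x" by blast
  then show "y \<oplus>\<^bsub>M\<^esub> z \<in> (\<lambda>a. a \<odot>\<^bsub>M\<^esub> x) ` carrier R"
    using assms by (intro image_eqI[of _ _ "a \<oplus> b"]) (auto simp: smult_l_distr)
next
  fix c y assume c: "c \<in> carrier R" and "y \<in> (\<lambda>a. a \<odot>\<^bsub>M\<^esub> x) ` carrier R"
  then obtain a where "a \<in> carrier R" "y = a \<odot>\<^bsub>M\<^esub> x" by blast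
  then show "c \<odot>\<^bsub>M\<^esub> y \<in> (\<lambda>a. a \<odot>\<^bsub>M\<^esub> x) ` carrier R"
    using assms c by (intro image_eqI[of _ _ "c \<otimes> a"]) (auto simp: smult_assoc1)
qed (use assms in auto)

lemma submodule_smult_image:
  assumes a: "a \<in> carrier R" and N: "submodule N R M"
  shows "submodule ((\<lambda>x. a \<odot>\<^bsub>M\<^esub> x) ` N) R M"
  unfolding submodule_iff
proof (intro conjI ballI)
  note N = submodule_simps[OF N]
  show "\<zero>\<^bsub>M\<^esub> \<in> (\<lambda>x. a \<odot>\<^bsub>M\<^esub> x) ` N" using a N by (intro image_eqI[of _ _ "\<zero>\<^bsub>M\<^esub>"]) auto
  show "(\<lambda>x. a \<odot>\<^bsub>M\<^esub> x) ` N \<subseteq> carrier M" using a N by auto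
next
  note N = submodule_simps[OF N]
  fix y z assume "y \<in> (\<lambda>x. a \<odot>\<^bsub>M\<^esub> x) ` N" "z \<in> (\<lambda>x. a \<odot>\<^bsub>M\<^esub> x) ` N"
  then obtain u v where "u \<in> N" "v \<in> N" "y = a \<odot>\<^bsub>M\<^esub> u" "z = a \<odot>\<^bsub>M\<^esub> v" by blast
  then show "y \<oplus>\<^bsub>M\<^esub> z \<in> (\<lambda>x. a \<odot>\<^bsub>M\<^esub> x) ` N"
    using a N by (intro image_eqI[of _ _ "u \<oplus>\<^bsub>M\<^esub> v"]) (auto simp: smult_r_distr)
next
  note N = submodule_simps[OF N]
  fix c y assume c: "c \<in> carrier R" and "y \<in> (\<lambda>x. a \<odot>\<^bsub>M\<^esub> x) ` N"
  then obtain u where "u \<in> N" "y = a \<odot>\<^bsub>M\<^esub> u" by blast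
  then show "c \<odot>\<^bsub>M\<^esub> y \<in> (\<lambda>x. a \<odot>\<^bsub>M\<^esub> x) ` N"
    using a c N by (intro image_eqI[of _ _ "c \<odot>\<^bsub>M\<^esub> u"]) (auto simp flip: smult_assoc1 simp: m_comm)
qed

text \<open>A chain \<open>C\<close> below \<open>B + R x\<close> is controlled by two chains: the
  intersections \<open>C i \<inter> B\<close>, and the ideals \<open>J i\<close> of the coefficients
  that \<open>x\<close> can have in elements \<open>b + a x\<close> of \<open>C i\<close>. Where
  both have stabilized, an element of a later member differs from one of \<open>C ?m\<close> by an
  element of \<open>B\<close>, which lies in the stable intersection.\<close>

lemma acc_on_submodules_add_cyclic:
  assumes R: "noetherian_ring R" and B: "submodule B R M" and x: "x \<in> carrier M"
    and acc: "acc_on {N. submodule N R M \<and> N \<subseteq> B}"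
  shows "acc_on {N. submodule N R M \<and> N \<subseteq> B <+>\<^bsub>M\<^esub> ((\<lambda>a. a \<odot>\<^bsub>M\<^esub> x) ` carrier R)}"
  unfolding acc_on_def
proof (intro allI impI)
  fix C :: "nat \<Rightarrow> 'c set"
  assume "mono C \<and> range C \<subseteq> {N. submodule N R M \<and> N \<subseteq> B <+>\<^bsub>M\<^esub> ((\<lambda>a. a \<odot>\<^bsub>M\<^esub> x) ` carrier R)}"
  then have C: "mono C" and sub: "\<And>i. submodule (C i) R M"
    and le: "\<And>i. C i \<subseteq> B <+>\<^bsub>M\<^esub> ((\<lambda>a. a \<odot>\<^bsub>M\<^esub> x) ` carrier R)" by auto
  have "mono (\<lambda>i. C i \<inter> B)" using C by (auto simp: mono_def)
  then obtain k where k: "\<And>i. k \<le> i \<Longrightarrow> C i \<inter> B = C k \<inter> B"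
    using acc_onD[OF acc, of "\<lambda>i. C i \<inter> B"] sub B submodule_Int by (auto simp: mono_def)
  define J where "J i = colon_ring R M (C i <+>\<^bsub>M\<^esub> B) {x}" for i
  have "mono J"
    using set_add_mono[OF monoD[OF C] subset_refl] unfolding mono_def J_def colon_ring_def by blast
  moreover have "ideal (J i) R" for i
    unfolding J_def using x sub B submodule_set_add by (intro ideal_colon_ring) auto
  ultimately obtain l where l: "\<And>i. l \<le> i \<Longrightarrow> J i = J l"
    using acc_onD[OF noetherian_ring.acc_on_ideals[OF R], of J] by auto
  let ?m = "max k l"
  have "C i \<subseteq> C ?m" if i: "?m \<le> i" for i
  proof
    fix y assume y: "y \<in> C i"
    then obtain b a where ba: "b \<in> B" "a \<in> carrier R" "y = b \<oplus>\<^bsub>M\<^esub> (a \<odot>\<^bsub>M\<^esub> x)"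
      using le unfolding mem_set_add_iff subset_iff by blast
    have yc: "y \<in> carrier M" "b \<in> carrier M" using y ba submodule_simps(2) sub B by auto
    have "a \<odot>\<^bsub>M\<^esub> x = y \<oplus>\<^bsub>M\<^esub> (\<ominus>\<^bsub>M\<^esub> b)"
      using ba yc x by (simp add: M.a_comm M.r_neg1 M.r_neg2)
    then have "a \<in> J i"
      using y ba submoduleE(3)[OF B] by (auto simp: J_def colon_ring_def mem_set_add_iff)
    then have "a \<in> J ?m" using l i by (metis max.bounded_iff max.cobounded2)
    then obtain c d where cd: "c \<in> C ?m" "d \<in> B" "a \<odot>\<^bsub>M\<^esub> x = c \<oplus>\<^bsub>M\<^esub> d"
      by (auto simp: J_def colon_ring_def mem_set_add_iff)
    have cc: "c \<in> carrier M" "d \<in> carrier M" using cd submodule_simps(2) sub B by auto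
    have eq: "y = c \<oplus>\<^bsub>M\<^esub> (b \<oplus>\<^bsub>M\<^esub> d)"
      using ba cd yc cc by (simp add: M.add.m_lcomm)
    have "c \<in> C i" using cd monoD[OF C i] by blast
    then have "b \<oplus>\<^bsub>M\<^esub> d \<in> C i"
      using submodule_add_cancel_left[OF sub, of c i "b \<oplus>\<^bsub>M\<^esub> d"] y eq yc cc by auto
    then have "b \<oplus>\<^bsub>M\<^esub> d \<in> C i \<inter> B" using submodule_simps(3)[OF B] ba cd by auto
    then have "b \<oplus>\<^bsub>M\<^esub> d \<in> C ?m" using k[of i] k[of ?m] i by auto
    then show "y \<in> C ?m" using submodule_simps(3)[OF sub] cd eq by auto
  qed
  then have "\<forall>i\<ge>?m. C i = C ?m" using monoD[OF C] by blast
  then show "\<exists>k. \<forall>i\<ge>k. C i = C k" by blast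
qed

text \<open>The induction over the generators only records some submodule above them that satisfies
  the chain condition; for a generating set this can only be \<open>M\<close> itself.\<close>

lemma acc_on_submodules:
  assumes R: "noetherian_ring R" and fg: "finitely_generated_module R M"
  shows "acc_on {N. submodule N R M}"
proof -
  have ex: "\<exists>B. submodule B R M \<and> A \<subseteq> B \<and> acc_on {N. submodule N R M \<and> N \<subseteq> B}"
    if "finite A" "A \<subseteq> carrier M" for A
    using that
  proof (induction A)
    case empty
    have zero: "N = {\<zero>\<^bsub>M\<^esub>}" if "submodule N R M \<and> N \<subseteq> {\<zero>\<^bsub>M\<^esub>}" for N
      using that by (auto simp: submodule_iff)
    have "C i = C 0" if "range C \<subseteq> {N. submodule N R M \<and> N \<subseteq> {\<zero>\<^bsub>M\<^esub>}}" for C :: "nat \<Rightarrow> _" and i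
      using range_subsetD[OF that, of i] range_subsetD[OF that, of 0] zero[of "C i"] zero[of "C 0"] by simp
    then have "acc_on {N. submodule N R M \<and> N \<subseteq> {\<zero>\<^bsub>M\<^esub>}}"
      unfolding acc_on_def by blast
    then show ?case using submodule_zero by blast
  next
    case (insert x A)
    then obtain B where B: "submodule B R M" "A \<subseteq> B" "acc_on {N. submodule N R M \<and> N \<subseteq> B}" by auto
    let ?B = "B <+>\<^bsub>M\<^esub> ((\<lambda>a. a \<odot>\<^bsub>M\<^esub> x) ` carrier R)"
    have x: "x \<in> carrier M" using insert by simp
    note cyc = submodule_cyclic[OF x]
    have "x = \<one> \<odot>\<^bsub>M\<^esub> x" using x by simp
    then have "x \<in> (\<lambda>a. a \<odot>\<^bsub>M\<^esub> x) ` carrier R" by (rule image_eqI) simp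
    then have "insert x A \<subseteq> ?B"
      using B subset_set_add[OF B(1) cyc] by blast
    then show ?case
      using submodule_set_add[OF B(1) cyc] acc_on_submodules_add_cyclic[OF R B(1) x B(3)] by blast
  qed
  obtain A where A: "finite A" "A \<subseteq> carrier M" "\<And>N. submodule N R M \<Longrightarrow> A \<subseteq> N \<Longrightarrow> N = carrier M"
    using fg unfolding finitely_generated_module_def by blast
  obtain B where "submodule B R M" "A \<subseteq> B" "acc_on {N. submodule N R M \<and> N \<subseteq> B}"
    using ex[OF A(1,2)] by blast
  moreover from this have "B = carrier M" using A(3) by blast
  moreover have "{N. submodule N R M \<and> N \<subseteq> carrier M} = {N. submodule N R M}"
    by (auto simp: submodule_iff)
  ultimately show ?thesis by simp
qed

end

section \<open>Noetherian families of submodules\<close>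

lemma (in module) smult_pow_Suc:
  assumes "a \<in> carrier R" "x \<in> carrier M"
  shows "(a [^] Suc k) \<odot>\<^bsub>M\<^esub> x = a \<odot>\<^bsub>M\<^esub> ((a [^] k) \<odot>\<^bsub>M\<^esub> x)"
  using assms by (simp add: smult_assoc1[symmetric] R.m_comm)

lemma (in module) smult_pow_left_commute:
  assumes "a \<in> carrier R" "c \<in> carrier R" "x \<in> carrier M"
  shows "c \<odot>\<^bsub>M\<^esub> ((a [^] (k::nat)) \<odot>\<^bsub>M\<^esub> x) = (a [^] k) \<odot>\<^bsub>M\<^esub> (c \<odot>\<^bsub>M\<^esub> x)"
  using assms by (simp add: smult_assoc1[symmetric] R.m_comm)

text \<open>A family \<open>N\<close> with \<open>stable_family A N\<close> is a homogeneous submodule of \<open>M[T]\<close>, with degree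
  \<open>n\<close> part \<open>N n T\<^sup>n\<close>, over the subring of \<open>R[T]\<close> generated by \<open>R\<close> and the \<open>a T\<close> with \<open>a \<in> A\<close>.\<close>

context module
begin

definition stable_family :: "'a set \<Rightarrow> (nat \<Rightarrow> 'c set) \<Rightarrow> bool" where
  "stable_family A N \<longleftrightarrow>
    (\<forall>n. submodule (N n) R M) \<and> (\<forall>a\<in>A. \<forall>n. \<forall>x\<in>N n. a \<odot>\<^bsub>M\<^esub> x \<in> N (Suc n))"

lemma stable_familyD:
  assumes "stable_family A N"
  shows "submodule (N n) R M" "a \<in> A \<Longrightarrow> x \<in> N n \<Longrightarrow> a \<odot>\<^bsub>M\<^esub> x \<in> N (Suc n)"
  using assms unfolding stable_family_def by auto

end

section \<open>One step of Hilbert's basis theorem for graded families\<close>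

locale family_adjoin = module R M for R (structure) and M (structure) +
  fixes A :: "'a set" and B :: "nat \<Rightarrow> 'c set" and a :: 'a
  assumes A: "A \<subseteq> carrier R" and B: "stable_family A B" and a: "a \<in> carrier R"
begin

text \<open>In terms of \<open>M[T]\<close>, \<open>lower k d\<close> is the part of degree \<open>k + d\<close> of the sum of the
  \<open>(a T)\<^sup>j B\<close> with \<open>j < k\<close>, and \<open>leading k N\<close> collects the coefficients of \<open>(a T)\<^sup>k\<close> in elements of
  \<open>N\<close> of the form \<open>b\<^sub>0 + (a T) b\<^sub>1 + \<dots> + (a T)\<^sup>k b\<^sub>k\<close>, as in Hilbert's basis theorem.\<close>

primrec lower :: "nat \<Rightarrow> nat \<Rightarrow> 'c set" where
  "lower 0 d = {\<zero>\<^bsub>M\<^esub>}"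
| "lower (Suc k) d = lower k (Suc d) <+>\<^bsub>M\<^esub> ((\<lambda>b. (a [^] k) \<odot>\<^bsub>M\<^esub> b) ` B (Suc d))"

text \<open>The degree \<open>n\<close> part of the sum of the \<open>(a T)^j B\<close> over all
  \<open>j\<close>: exponents \<open>j < n\<close> are in \<open>lower n 0\<close>, and
  \<open>j = n\<close> uses the degree 0 part of \<open>B\<close>.\<close>

definition adjoin :: "nat \<Rightarrow> 'c set" where
  "adjoin n = lower n 0 <+>\<^bsub>M\<^esub> ((\<lambda>b. (a [^] n) \<odot>\<^bsub>M\<^esub> b) ` B 0)"

definition leading :: "nat \<Rightarrow> (nat \<Rightarrow> 'c set) \<Rightarrow> nat \<Rightarrow> 'c set" where
  "leading k N d = {b \<in> B d. \<exists>u\<in>lower k d. u \<oplus>\<^bsub>M\<^esub> (a [^] k) \<odot>\<^bsub>M\<^esub> b \<in> N (k + d)}"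

lemma B_carrier: "b \<in> B d \<Longrightarrow> b \<in> carrier M"
  using submodule_simps(2)[OF stable_familyD(1)[OF B]] .

lemma submodule_pow_image: "submodule ((\<lambda>b. (a [^] (k::nat)) \<odot>\<^bsub>M\<^esub> b) ` B d) R M"
  using a stable_familyD(1)[OF B] by (intro submodule_smult_image) auto

lemma submodule_lower: "submodule (lower k d) R M"
  by (induction k arbitrary: d) (simp_all add: submodule_zero submodule_set_add submodule_pow_image)

lemma lower_carrier: "u \<in> lower k d \<Longrightarrow> u \<in> carrier M"
  using submodule_simps(2)[OF submodule_lower] .

lemma lower_Suc_memI:
  "u \<in> lower k (Suc d) \<Longrightarrow> b \<in> B (Suc d) \<Longrightarrow> u \<oplus>\<^bsub>M\<^esub> (a [^] k) \<odot>\<^bsub>M\<^esub> b \<in> lower (Suc k) d"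
  by (simp add: set_addI)

lemma lower_Suc_memE:
  assumes "x \<in> lower (Suc k) d"
  obtains u b where "u \<in> lower k (Suc d)" "b \<in> B (Suc d)" "x = u \<oplus>\<^bsub>M\<^esub> (a [^] k) \<odot>\<^bsub>M\<^esub> b"
  using assms by (auto simp: mem_set_add_iff)

text \<open>Multiplication by \<open>c T\<close> with \<open>c\<close> in \<open>A\<close> acts on
  the coefficients in \<open>B\<close> and raises \<open>d\<close>, whereas multiplication by
  \<open>a T\<close> shifts the exponents and raises \<open>k\<close>. This lemma and the next treat
  the two cases.\<close>

lemma smult_lower:
  assumes c: "c \<in> A"
  shows "u \<in> lower k d \<Longrightarrow> c \<odot>\<^bsub>M\<^esub> u \<in> lower k (Suc d)"
proof (induction k arbitrary: d u)
  case 0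
  then show ?case using A c by auto
next
  case (Suc k)
  from Suc.prems obtain v b where vb: "v \<in> lower k (Suc d)" "b \<in> B (Suc d)"
    "u = v \<oplus>\<^bsub>M\<^esub> (a [^] k) \<odot>\<^bsub>M\<^esub> b" by (rule lower_Suc_memE)
  have "c \<odot>\<^bsub>M\<^esub> u = c \<odot>\<^bsub>M\<^esub> v \<oplus>\<^bsub>M\<^esub> (a [^] k) \<odot>\<^bsub>M\<^esub> (c \<odot>\<^bsub>M\<^esub> b)"
    using vb A c a lower_carrier[OF vb(1)] B_carrier[OF vb(2)]
    by (simp add: smult_r_distr smult_pow_left_commute subset_iff)
  then show ?case
    using lower_Suc_memI[OF Suc.IH[OF vb(1)] stable_familyD(2)[OF B c vb(2)]] by simp
qed

lemma smult_gen_lower: "u \<in> lower k d \<Longrightarrow> a \<odot>\<^bsub>M\<^esub> u \<in> lower (Suc k) d"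
proof (induction k arbitrary: d u)
  case 0
  then have "a \<odot>\<^bsub>M\<^esub> u = \<zero>\<^bsub>M\<^esub>" using a by simp
  then show ?case using submodule_simps(1)[OF submodule_lower] by metis
next
  case (Suc k)
  from Suc.prems obtain v b where vb: "v \<in> lower k (Suc d)" "b \<in> B (Suc d)"
    "u = v \<oplus>\<^bsub>M\<^esub> (a [^] k) \<odot>\<^bsub>M\<^esub> b" by (rule lower_Suc_memE)
  have "a \<odot>\<^bsub>M\<^esub> u = a \<odot>\<^bsub>M\<^esub> v \<oplus>\<^bsub>M\<^esub> (a [^] Suc k) \<odot>\<^bsub>M\<^esub> b"
    using vb a lower_carrier[OF vb(1)] B_carrier[OF vb(2)] smult_pow_Suc[of a b k]
    by (simp add: smult_r_distr)
  then show ?case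
    using lower_Suc_memI[OF Suc.IH[OF vb(1)] vb(2)] by simp
qed

lemma adjoin_memI:
  "u \<in> lower n 0 \<Longrightarrow> b \<in> B 0 \<Longrightarrow> u \<oplus>\<^bsub>M\<^esub> (a [^] n) \<odot>\<^bsub>M\<^esub> b \<in> adjoin n"
  by (simp add: adjoin_def set_addI)

lemma adjoin_memE:
  assumes "x \<in> adjoin n"
  obtains u b where "u \<in> lower n 0" "b \<in> B 0" "x = u \<oplus>\<^bsub>M\<^esub> (a [^] n) \<odot>\<^bsub>M\<^esub> b"
  using assms by (auto simp: adjoin_def mem_set_add_iff)

lemma lower_subset_adjoin: "lower n 0 \<subseteq> adjoin n"
  using subset_set_add(1)[OF submodule_lower submodule_pow_image] by (simp add: adjoin_def)

lemma adjoin_0: "adjoin 0 = B 0"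
proof -
  have "x \<in> adjoin 0 \<longleftrightarrow> x \<in> B 0" for x
    unfolding adjoin_def mem_set_add_iff using B_carrier by auto
  then show ?thesis by blast
qed

lemma stable_family_adjoin: "stable_family (insert a A) adjoin"
  unfolding stable_family_def
proof (intro conjI allI ballI)
  show "submodule (adjoin n) R M" for n
    unfolding adjoin_def using submodule_set_add submodule_lower submodule_pow_image by blast
next
  fix c n x assume c: "c \<in> insert a A" and "x \<in> adjoin n"
  from this(2) obtain u b where ub: "u \<in> lower n 0" "b \<in> B 0"
    and x: "x = u \<oplus>\<^bsub>M\<^esub> (a [^] n) \<odot>\<^bsub>M\<^esub> b" by (rule adjoin_memE)
  note carr = lower_carrier[OF ub(1)] B_carrier[OF ub(2)]
  show "c \<odot>\<^bsub>M\<^esub> x \<in> adjoin (Suc n)"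
  proof (cases "c = a")
    case True
    have "a \<odot>\<^bsub>M\<^esub> x = a \<odot>\<^bsub>M\<^esub> u \<oplus>\<^bsub>M\<^esub> (a [^] Suc n) \<odot>\<^bsub>M\<^esub> b"
      using x a carr smult_pow_Suc[of a b n] by (simp add: smult_r_distr)
    then show ?thesis
      using True adjoin_memI[OF smult_gen_lower[OF ub(1)] ub(2)] by simp
  next
    case False
    then have cA: "c \<in> A" "c \<in> carrier R" using c A by auto
    have "c \<odot>\<^bsub>M\<^esub> x = c \<odot>\<^bsub>M\<^esub> u \<oplus>\<^bsub>M\<^esub> (a [^] n) \<odot>\<^bsub>M\<^esub> (c \<odot>\<^bsub>M\<^esub> b)"
      using x a cA(2) carr by (simp add: smult_r_distr smult_pow_left_commute)
    also have "\<dots> \<in> lower (Suc n) 0"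
      using lower_Suc_memI[OF smult_lower[OF cA(1) ub(1)] stable_familyD(2)[OF B cA(1) ub(2)]] .
    finally show ?thesis using lower_subset_adjoin by blast
  qed
qed

text \<open>This puts the families of leading coefficients under the chain condition assumed for
  \<open>B\<close>.\<close>

lemma stable_family_leading:
  assumes N: "stable_family (insert a A) N"
  shows "stable_family A (leading k N)" "leading k N \<le> B"
proof -
  note Ns = stable_familyD[OF N]
  note Bs = submodule_simps[OF stable_familyD(1)[OF B]]
  note Ls = submodule_simps[OF submodule_lower]
  show "leading k N \<le> B" by (auto simp: le_fun_def leading_def)
  show "stable_family A (leading k N)"
    unfolding stable_family_def
  proof (intro conjI allI ballI)
    fix d
    show "submodule (leading k N d) R M"
      unfolding submodule_iff
    proof (intro conjI ballI)
      show "leading k N d \<subseteq> carrier M" using B_carrier by (auto simp: leading_def)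
      have "\<zero>\<^bsub>M\<^esub> \<oplus>\<^bsub>M\<^esub> (a [^] k) \<odot>\<^bsub>M\<^esub> \<zero>\<^bsub>M\<^esub> \<in> N (k + d)"
        using a submodule_simps(1)[OF Ns(1)] by simp
      then show "\<zero>\<^bsub>M\<^esub> \<in> leading k N d" unfolding leading_def using Bs(1) Ls(1) by blast
    next
      fix b b' assume "b \<in> leading k N d" "b' \<in> leading k N d"
      then obtain u u' where b: "b \<in> B d" "b' \<in> B d" and u: "u \<in> lower k d" "u' \<in> lower k d"
        and n: "u \<oplus>\<^bsub>M\<^esub> (a [^] k) \<odot>\<^bsub>M\<^esub> b \<in> N (k + d)" "u' \<oplus>\<^bsub>M\<^esub> (a [^] k) \<odot>\<^bsub>M\<^esub> b' \<in> N (k + d)"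
        by (auto simp: leading_def)
      have "(u \<oplus>\<^bsub>M\<^esub> u') \<oplus>\<^bsub>M\<^esub> (a [^] k) \<odot>\<^bsub>M\<^esub> (b \<oplus>\<^bsub>M\<^esub> b')
          = (u \<oplus>\<^bsub>M\<^esub> (a [^] k) \<odot>\<^bsub>M\<^esub> b) \<oplus>\<^bsub>M\<^esub> (u' \<oplus>\<^bsub>M\<^esub> (a [^] k) \<odot>\<^bsub>M\<^esub> b')"
        using lower_carrier u B_carrier b a by (simp add: smult_r_distr M.add.m_ac)
      also have "\<dots> \<in> N (k + d)" using submodule_simps(3)[OF Ns(1) n] .
      finally show "b \<oplus>\<^bsub>M\<^esub> b' \<in> leading k N d"
        unfolding leading_def using Bs(3)[OF b] Ls(3)[OF u] by blast
    next
      fix c b assume c: "c \<in> carrier R" and "b \<in> leading k N d"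
      then obtain u where b: "b \<in> B d" and u: "u \<in> lower k d"
        and n: "u \<oplus>\<^bsub>M\<^esub> (a [^] k) \<odot>\<^bsub>M\<^esub> b \<in> N (k + d)" by (auto simp: leading_def)
      have "c \<odot>\<^bsub>M\<^esub> u \<oplus>\<^bsub>M\<^esub> (a [^] k) \<odot>\<^bsub>M\<^esub> (c \<odot>\<^bsub>M\<^esub> b) = c \<odot>\<^bsub>M\<^esub> (u \<oplus>\<^bsub>M\<^esub> (a [^] k) \<odot>\<^bsub>M\<^esub> b)"
        using lower_carrier[OF u] B_carrier[OF b] a c by (simp add: smult_r_distr smult_pow_left_commute)
      also have "\<dots> \<in> N (k + d)" using submodule_simps(5)[OF Ns(1) c n] .
      finally show "c \<odot>\<^bsub>M\<^esub> b \<in> leading k N d"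
        unfolding leading_def using Bs(5)[OF c b] Ls(5)[OF c u] by blast
    qed
  next
    fix c d b assume c: "c \<in> A" and "b \<in> leading k N d"
    then obtain u where b: "b \<in> B d" and u: "u \<in> lower k d"
      and n: "u \<oplus>\<^bsub>M\<^esub> (a [^] k) \<odot>\<^bsub>M\<^esub> b \<in> N (k + d)" by (auto simp: leading_def)
    have "c \<odot>\<^bsub>M\<^esub> u \<oplus>\<^bsub>M\<^esub> (a [^] k) \<odot>\<^bsub>M\<^esub> (c \<odot>\<^bsub>M\<^esub> b) = c \<odot>\<^bsub>M\<^esub> (u \<oplus>\<^bsub>M\<^esub> (a [^] k) \<odot>\<^bsub>M\<^esub> b)"
      using lower_carrier[OF u] B_carrier[OF b] a c A
      by (simp add: smult_r_distr smult_pow_left_commute subset_iff)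
    also have "\<dots> \<in> N (k + Suc d)" using Ns(2)[of c, OF _ n] c by simp
    finally show "c \<odot>\<^bsub>M\<^esub> b \<in> leading k N (Suc d)"
      unfolding leading_def using stable_familyD(2)[OF B c b] smult_lower[OF c u] by blast
  qed
qed

lemma leading_mono: "N \<le> N' \<Longrightarrow> leading k N \<le> leading k N'"
  unfolding le_fun_def leading_def by blast

text \<open>Multiplying an element by \<open>a T\<close> keeps its leading coefficient and moves it
  one exponent up.\<close>

lemma leading_Suc:
  assumes N: "stable_family (insert a A) N"
  shows "leading k N \<le> leading (Suc k) N"
  unfolding le_fun_def
proof (intro allI subsetI)
  fix d b assume "b \<in> leading k N d"
  then obtain u where b: "b \<in> B d" and u: "u \<in> lower k d"
    and n: "u \<oplus>\<^bsub>M\<^esub> (a [^] k) \<odot>\<^bsub>M\<^esub> b \<in> N (k + d)" by (auto simp: leading_def)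
  have "a \<odot>\<^bsub>M\<^esub> u \<oplus>\<^bsub>M\<^esub> (a [^] Suc k) \<odot>\<^bsub>M\<^esub> b = a \<odot>\<^bsub>M\<^esub> (u \<oplus>\<^bsub>M\<^esub> (a [^] k) \<odot>\<^bsub>M\<^esub> b)"
    using lower_carrier[OF u] B_carrier[OF b] a smult_pow_Suc[of a b k] by (simp add: smult_r_distr)
  also have "\<dots> \<in> N (Suc k + d)" using stable_familyD(2)[OF N _ n, of a] by simp
  finally show "b \<in> leading (Suc k) N d"
    unfolding leading_def using b smult_gen_lower[OF u] by blast
qed

text \<open>As in Hilbert's basis theorem, an element of \<open>N'\<close> is reduced by elements of
  \<open>N\<close> with the same leading coefficient until nothing is left; \<open>key\<close>
  performs this by induction on the top exponent of \<open>a T\<close>.\<close>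

lemma family_eq_if_leading_eq:
  assumes N: "stable_family (insert a A) N" and N': "stable_family (insert a A) N'"
    and le: "N \<le> N'" "N' \<le> adjoin" and eq: "\<And>k. leading k N = leading k N'"
  shows "N = N'"
proof (rule antisym)
  note Ns = stable_familyD[OF N] and N's = stable_familyD[OF N']
  have key: "x \<in> N (k + d)"
    if "u \<in> lower k d" "b \<in> B d" "x = u \<oplus>\<^bsub>M\<^esub> (a [^] k) \<odot>\<^bsub>M\<^esub> b" "x \<in> N' (k + d)" for x k d u b
    using that
  proof (induction k arbitrary: x d u b)
    case (0 x d u b)
    then have "b \<in> leading 0 N' d" by (auto simp: leading_def)
    then have "b \<in> leading 0 N d" using eq by simp
    then show ?case using 0 by (auto simp: leading_def)
  next
    case (Suc k x d u b)
    then have "b \<in> leading (Suc k) N' d" unfolding leading_def by blast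
    then have "b \<in> leading (Suc k) N d" using eq by simp
    then obtain v where v: "v \<in> lower (Suc k) d"
      and vN: "v \<oplus>\<^bsub>M\<^esub> (a [^] Suc k) \<odot>\<^bsub>M\<^esub> b \<in> N (Suc k + d)" unfolding leading_def by blast
    let ?y = "(a [^] Suc k) \<odot>\<^bsub>M\<^esub> b"
    have carr: "u \<in> carrier M" "v \<in> carrier M" "?y \<in> carrier M"
      using lower_carrier[OF Suc.prems(1)] lower_carrier[OF v] B_carrier[OF Suc.prems(2)] a by simp_all
    have vN': "v \<oplus>\<^bsub>M\<^esub> ?y \<in> N' (Suc k + d)" using vN le(1) by (auto simp: le_fun_def)
    \<comment> \<open>Both elements have \<open>b\<close> as coefficient of exponent
      \<open>Suc k\<close>, so subtracting leaves exponents at most \<open>k\<close>. The degree is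
      unchanged, but must be read as \<open>k + Suc d\<close> for the induction hypothesis.\<close>
    have uv: "u \<ominus>\<^bsub>M\<^esub> v = x \<ominus>\<^bsub>M\<^esub> (v \<oplus>\<^bsub>M\<^esub> ?y)"
      unfolding Suc.prems(3) using carr
      by (simp add: M.minus_eq M.minus_add M.add.m_ac M.r_neg M.r_neg1 M.r_neg2)
    have "u \<ominus>\<^bsub>M\<^esub> v \<in> N' (k + Suc d)"
      unfolding uv using submodule_simps(4)[OF N's(1) Suc.prems(4) vN'] by simp
    moreover obtain w b' where wb: "w \<in> lower k (Suc d)" "b' \<in> B (Suc d)"
      "u \<ominus>\<^bsub>M\<^esub> v = w \<oplus>\<^bsub>M\<^esub> (a [^] k) \<odot>\<^bsub>M\<^esub> b'"
      using submodule_simps(4)[OF submodule_lower Suc.prems(1) v] lower_Suc_memE by metis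
    ultimately have "u \<ominus>\<^bsub>M\<^esub> v \<in> N (k + Suc d)" using Suc.IH[OF wb] by blast
    then have "u \<ominus>\<^bsub>M\<^esub> v \<in> N (Suc k + d)" by simp
    moreover have "x = (u \<ominus>\<^bsub>M\<^esub> v) \<oplus>\<^bsub>M\<^esub> (v \<oplus>\<^bsub>M\<^esub> ?y)"
      unfolding Suc.prems(3) using carr
      by (simp add: M.minus_eq M.add.m_ac M.r_neg1 M.r_neg2)
    ultimately show ?case using vN submodule_simps(3)[OF Ns(1)] by simp
  qed
  show "N' \<le> N"
    unfolding le_fun_def
  proof (intro allI subsetI)
    fix n x assume x: "x \<in> N' n"
    then have "x \<in> adjoin n" using le(2) by (auto simp: le_fun_def)
    then obtain u b where "u \<in> lower n 0" "b \<in> B 0" "x = u \<oplus>\<^bsub>M\<^esub> (a [^] n) \<odot>\<^bsub>M\<^esub> b"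
      by (rule adjoin_memE)
    with key[of u n 0 b x] x show "x \<in> N n" by simp
  qed
qed (rule le(1))

text \<open>The families \<open>leading k (C i)\<close> increase in both indices. The diagonal
  stabilizes, which settles all large \<open>k\<close> at once and leaves finitely many rows to
  treat separately.\<close>

lemma acc_on_adjoin:
  assumes acc: "acc_on {N. stable_family A N \<and> N \<le> B}"
  shows "acc_on {N. stable_family (insert a A) N \<and> N \<le> adjoin}"
  unfolding acc_on_def
proof (intro allI impI)
  fix C :: "nat \<Rightarrow> nat \<Rightarrow> 'c set"
  assume "mono C \<and> range C \<subseteq> {N. stable_family (insert a A) N \<and> N \<le> adjoin}"
  then have C: "mono C" and st: "\<And>i. stable_family (insert a A) (C i)" and le: "\<And>i. C i \<le> adjoin"
    by auto
  have mem: "leading k (C i) \<in> {N. stable_family A N \<and> N \<le> B}" for k i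
    using stable_family_leading[OF st] by simp
  have le_k: "leading k (C i) \<le> leading l (C i)" if "k \<le> l" for k l i
    using lift_Suc_mono_le[of "\<lambda>k. leading k (C i)", OF leading_Suc[OF st] that] .
  have le_i: "leading k (C i) \<le> leading k (C j)" if "i \<le> j" for k i j
    using leading_mono[OF monoD[OF C that]] .
  have le2: "leading k (C i) \<le> leading l (C j)" if "k \<le> l" "i \<le> j" for k l i j
    using order_trans[OF le_k[OF that(1)] le_i[OF that(2)]] .
  have "mono (\<lambda>i. leading i (C i))" using le2 by (auto simp: mono_def)
  then obtain m where m: "\<And>i. m \<le> i \<Longrightarrow> leading i (C i) = leading m (C m)"
    using acc_onD[OF acc, of "\<lambda>i. leading i (C i)"] mem by blast
  \<comment> \<open>The value is squeezed between the diagonal entries at \<open>m\<close> and at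
    \<open>max k i\<close>, which agree.\<close>
  have big: "leading k (C i) = leading m (C m)" if "m \<le> k" "m \<le> i" for k i
    using le2[OF that] le2[of k "max k i" i "max k i"] m[of "max k i"] that by (intro antisym) auto
  have "\<exists>s. \<forall>i\<ge>s. leading k (C i) = leading k (C s)" for k
  proof -
    have "mono (\<lambda>i. leading k (C i))" using le_i by (auto simp: mono_def)
    then show ?thesis using acc_onD[OF acc, of "\<lambda>i. leading k (C i)"] mem by metis
  qed
  then obtain s where s: "\<And>k i. s k \<le> i \<Longrightarrow> leading k (C i) = leading k (C (s k))" by metis
  \<comment> \<open>Beyond \<open>p\<close> the rows \<open>k < m\<close> are stable by the choice
    of \<open>s\<close>, and all others by \<open>big\<close>.\<close>
  define p where "p = Max (insert m (s ` {..<m}))"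
  have "m \<le> p" by (simp add: p_def)
  have sp: "s k \<le> p" if "k < m" for k using that by (auto simp: p_def intro!: Max_ge)
  have "C i = C p" if i: "p \<le> i" for i
  proof (rule family_eq_if_leading_eq[symmetric])
    show "leading k (C p) = leading k (C i)" for k
    proof (cases "k < m")
      case True
      then show ?thesis using s[of k i] s[of k p] sp[OF True] i by simp
    next
      case False
      then show ?thesis using big[of k i] big[of k p] i \<open>m \<le> p\<close> by simp
    qed
  qed (use st le monoD[OF C i] in auto)
  then show "\<exists>k. \<forall>i\<ge>k. C i = C k" by blast
qed

end

section \<open>Stabilization of families below the ideal powers\<close>

context module
begin

text \<open>Without generators there is no link between the degrees, so \<open>M\<close>
  concentrated in degree 0 inherits the chain condition of \<open>M\<close>; each generator is then
  adjoined by \<open>family_adjoin\<close>. The value at 0 is recorded in order to compare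
  \<open>B\<close> with the powers of the ideal.\<close>

lemma ex_noetherian_family:
  assumes acc: "acc_on {N. submodule N R M}" and "finite A" "A \<subseteq> carrier R"
  shows "\<exists>B. stable_family A B \<and> B 0 = carrier M \<and> acc_on {N. stable_family A N \<and> N \<le> B}"
  using assms(2,3)
proof (induction A)
  case empty
  define B where "B = (\<lambda>n::nat. if n = 0 then carrier M else {\<zero>\<^bsub>M\<^esub>})"
  have "stable_family {} B"
    by (simp add: stable_family_def B_def carrier_is_submodule submodule_zero)
  moreover have "acc_on {N. stable_family {} N \<and> N \<le> B}"
    unfolding acc_on_def
  proof (intro allI impI)
    fix C :: "nat \<Rightarrow> nat \<Rightarrow> 'c set"
    assume "mono C \<and> range C \<subseteq> {N. stable_family {} N \<and> N \<le> B}"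
    then have C: "mono C" and st: "\<And>i. stable_family {} (C i)" and le: "\<And>i n. C i n \<subseteq> B n"
      by (auto simp: le_fun_def)
    have "mono (\<lambda>i. C i 0)" using C by (auto simp: mono_def le_fun_def)
    then obtain k where k: "\<And>i. k \<le> i \<Longrightarrow> C i 0 = C k 0"
      using acc_onD[OF acc, of "\<lambda>i. C i 0"] stable_familyD(1)[OF st] by blast
    have "C i n = {\<zero>\<^bsub>M\<^esub>}" if "n \<noteq> 0" for i n
      using le[of i n] submodule_simps(1)[OF stable_familyD(1)[OF st, of i n]] that by (auto simp: B_def)
    then have "C i n = C k n" if "k \<le> i" for i n
      using k[OF that] by (cases "n = 0") auto
    then show "\<exists>k. \<forall>i\<ge>k. C i = C k" by blast
  qed
  ultimately show ?case by (intro exI[of _ B]) (simp add: B_def)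
next
  case (insert a A)
  then obtain B where B: "stable_family A B" "B 0 = carrier M"
    and acc_B: "acc_on {N. stable_family A N \<and> N \<le> B}"
    by auto
  interpret adj: family_adjoin R M A B a
    by unfold_locales (use insert B in auto)
  show ?case
    using adj.stable_family_adjoin adj.adjoin_0 B(2) adj.acc_on_adjoin[OF acc_B] by auto
qed

text \<open>This expresses finite generation of the Rees submodule given by \<open>N\<close>: its
  truncations, generated in degrees up to \<open>i\<close>, form an ascending chain below a
  Noetherian family, so one of them is already everything.\<close>

lemma ideal_smult_family_stabilizes:
  assumes R: "noetherian_ring R" and fg: "finitely_generated_module R M" and I: "ideal I R"
    and N: "\<And>n. submodule (N n) R M" "\<And>n. ideal_smult M I (N n) \<subseteq> N (Suc n)"
      "\<And>n. N n \<subseteq> ideal_power_module R I n M"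
  shows "\<exists>n\<^sub>0. \<forall>n\<ge>n\<^sub>0. N (Suc n) = ideal_smult M I (N n)"
proof -
  obtain A where A: "A \<subseteq> carrier R" "finite A" "I = Idl A"
    using noetherian_ring.finetely_gen[OF R I] by blast
  have AI: "A \<subseteq> I" using A genideal_self by blast
  obtain B where B: "stable_family A B" "B 0 = carrier M" "acc_on {N. stable_family A N \<and> N \<le> B}"
    using ex_noetherian_family[OF acc_on_submodules[OF R fg] A(2,1)] by blast
  \<comment> \<open>The family \<open>B\<close> is closed only under the generators of
    \<open>I\<close>; closure under all of \<open>I\<close> follows since each
    \<open>B (Suc n)\<close> is a submodule.\<close>
  have powB: "ideal_power_module R I n M \<subseteq> B n" for n
  proof (induction n)
    case 0
    then show ?case using B(2) by (simp add: ideal_power_module_0)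
  next
    case (Suc n)
    have "ideal_smult M I (B n) \<subseteq> B (Suc n)"
      unfolding ideal_smult_subset_iff[OF stable_familyD(1)[OF B(1)]] A(3)
      using smult_genideal_closed[OF stable_familyD(1)[OF B(1)] _ A(1) stable_familyD(2)[OF B(1)]]
        submodule_simps(2)[OF stable_familyD(1)[OF B(1)]] by blast
    with Suc show ?case
      using ideal_smult_mono[of I I] by (simp add: ideal_power_module_Suc[OF I]) blast
  qed
  \<comment> \<open>The family \<open>C i\<close> agrees with \<open>N\<close> up to degree
    \<open>i\<close> and is generated by degree \<open>i\<close> from there on.\<close>
  define C where "C i n = (if n \<le> i then N n else ((ideal_smult M I) ^^ (n - i)) (N i))" for i n
  have C_Suc: "C i (Suc n) = ideal_smult M I (C i n)" if "i \<le> n" for i n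
    using that by (cases "n = i") (auto simp: C_def Suc_diff_le)
  have sub: "submodule (C i n) R M" for i n
  proof (induction n)
    case (Suc n)
    then show ?case
      using N(1) C_Suc[of i n] submodule_ideal_smult[OF I] by (cases "i \<le> n") (auto simp: C_def)
  qed (simp add: C_def N(1))
  have CN: "C i n \<subseteq> N n" for i n
  proof (induction n)
    case (Suc n)
    then show ?case
      using N(2)[of n] C_Suc[of i n] ideal_smult_mono[OF subset_refl Suc, of I]
      by (cases "i \<le> n") (auto simp: C_def)
  qed (simp add: C_def)
  have IC: "ideal_smult M I (C i n) \<subseteq> C i (Suc n)" for i n
    using N(2)[of n] C_Suc[of i n] by (cases "i \<le> n") (auto simp: C_def)
  have "stable_family A (C i)" for i
    unfolding stable_family_def
    using sub IC[of i] AI ideal_smult.smult[of _ I _ _ M] by (meson subsetD)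
  moreover have "C i \<le> B" for i
    unfolding le_fun_def using CN N(3) powB by blast
  moreover have "mono C"
    unfolding mono_iff_le_Suc le_fun_def
  proof (intro allI)
    fix i n
    show "C i n \<subseteq> C (Suc i) n"
    proof (cases "n \<le> Suc i")
      case True
      then show ?thesis using CN[of i n] by (simp add: C_def)
    next
      case False
      then have "Suc i \<le> n" by simp
      then show ?thesis
      proof (induction n rule: dec_induct)
        case base
        then show ?case using CN[of i "Suc i"] by (simp add: C_def)
      next
        case (step n)
        then show ?case using ideal_smult_mono[of I I] by (simp add: C_Suc)
      qed
    qed
  qed
  ultimately obtain k where k: "\<And>i. k \<le> i \<Longrightarrow> C i = C k"
    using acc_onD[OF B(3), of C] by auto
  \<comment> \<open>The families \<open>C n\<close> and \<open>C (Suc n)\<close> first have a chance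
    to differ in degree \<open>Suc n\<close>, where they are \<open>I N n\<close> and
    \<open>N (Suc n)\<close>.\<close>
  have "N (Suc n) = ideal_smult M I (N n)" if "k \<le> n" for n
  proof -
    have "N (Suc n) = C (Suc n) (Suc n)" by (simp add: C_def)
    also have "\<dots> = C n (Suc n)" using k[of n] k[of "Suc n"] that by simp
    also have "\<dots> = ideal_smult M I (N n)" using C_Suc[of n n] by (simp add: C_def)
    finally show ?thesis .
  qed
  then show ?thesis by blast
qed

end

section \<open>Colon submodules of ideal powers\<close>

context module
begin

lemma submodule_colon_module:
  assumes N: "submodule N R M" and J: "J \<subseteq> carrier R"
  shows "submodule (colon_module M N J) R M"
proof -
  note Ns = submodule_simps[OF N]
  have "c \<odot>\<^bsub>M\<^esub> x \<in> colon_module M N J" if "c \<in> carrier R" "x \<in> colon_module M N J" for c x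
  proof -
    have "a \<odot>\<^bsub>M\<^esub> (c \<odot>\<^bsub>M\<^esub> x) = c \<odot>\<^bsub>M\<^esub> (a \<odot>\<^bsub>M\<^esub> x)" if "a \<in> J" for a
      using that \<open>c \<in> carrier R\<close> \<open>x \<in> colon_module M N J\<close> J
      by (auto simp: colon_module_def smult_assoc1[symmetric] R.m_comm subset_iff)
    then show ?thesis using that Ns(5) by (auto simp: colon_module_def)
  qed
  moreover have "x \<oplus>\<^bsub>M\<^esub> y \<in> colon_module M N J"
    if "x \<in> colon_module M N J" "y \<in> colon_module M N J" for x y
    using that J Ns(3) by (auto simp: colon_module_def smult_r_distr subset_iff)
  moreover have "\<zero>\<^bsub>M\<^esub> \<in> colon_module M N J" "colon_module M N J \<subseteq> carrier M"
    using J Ns(1) by (auto simp: colon_module_def subset_iff)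
  ultimately show ?thesis unfolding submodule_iff by blast
qed

lemma colon_module_Idl:
  assumes "submodule N R M" "A \<subseteq> carrier R"
  shows "colon_module M N (Idl A) = colon_module M N A"
proof
  show "colon_module M N (Idl A) \<subseteq> colon_module M N A"
    using genideal_self[OF assms(2)] by (auto simp: colon_module_def)
  show "colon_module M N A \<subseteq> colon_module M N (Idl A)"
  proof
    fix x assume x: "x \<in> colon_module M N A"
    have "r \<odot>\<^bsub>M\<^esub> x \<in> N" if "r \<in> Idl A" for r
      by (rule smult_genideal_closed[OF assms(1) _ assms(2) _ that, of "{x}"])
        (use x in \<open>simp_all add: colon_module_def\<close>)
    with x show "x \<in> colon_module M N (Idl A)" by (simp add: colon_module_def)
  qed
qed

lemma smult_colon_module: "x \<in> colon_module M N J \<Longrightarrow> a \<in> J \<Longrightarrow> a \<odot>\<^bsub>M\<^esub> x \<in> N"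
  by (auto simp: colon_module_def)

end

locale noetherian_module = module R M for R (structure) and M (structure) +
  fixes I :: "'a set"
  assumes R: "noetherian_ring R" and fg: "finitely_generated_module R M" and I: "ideal I R"
begin

abbreviation P :: "nat \<Rightarrow> 'c set" where "P n \<equiv> ideal_power_module R I n M"

lemmas subP = submodule_ideal_power_module[OF I]
lemmas P_Suc = ideal_power_module_Suc[OF I]
lemmas P_antimono = ideal_power_module_antimono[OF I]

lemma I_carrier: "I \<subseteq> carrier R"
  using ideal.Icarr[OF I] by blast

lemma smult_P: "a \<in> I \<Longrightarrow> x \<in> P n \<Longrightarrow> a \<odot>\<^bsub>M\<^esub> x \<in> P (Suc n)"
  by (simp add: P_Suc ideal_smult.smult)

text \<open>The family \<open>P n \<inter> S\<close> stabilizes, hence \<open>P (n\<^sub>0 + i)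
  \<inter> S = I\<^sup>i (P n\<^sub>0 \<inter> S)\<close> as in the Artin-Rees lemma. Since
  \<open>n\<^sub>0\<close> is not known beforehand, \<open>ST\<close> has to cover every subset of
  \<open>S\<close>.\<close>

lemma weak_artin_rees:
  assumes S: "submodule S R M" and T: "submodule T R M"
    and ST: "\<And>N. N \<subseteq> S \<Longrightarrow> ((ideal_smult M I) ^^ j) N \<subseteq> T"
  shows "\<exists>n\<^sub>0. \<forall>n\<ge>n\<^sub>0. P n \<inter> S \<subseteq> T"
proof -
  have "\<exists>n\<^sub>0. \<forall>n\<ge>n\<^sub>0. P (Suc n) \<inter> S = ideal_smult M I (P n \<inter> S)"
  proof (rule ideal_smult_family_stabilizes[OF R fg I])
    show "submodule (P n \<inter> S) R M" for n using submodule_Int[OF subP S] .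
    show "ideal_smult M I (P n \<inter> S) \<subseteq> P (Suc n) \<inter> S" for n
      using ideal_smult_mono[of I I "P n \<inter> S" "P n"] ideal_smult_mono[of I I "P n \<inter> S" S]
        ideal_smult_subset[OF I S] by (auto simp: P_Suc)
  qed blast
  then obtain n\<^sub>0 where n\<^sub>0: "\<And>n. n\<^sub>0 \<le> n \<Longrightarrow> P (Suc n) \<inter> S = ideal_smult M I (P n \<inter> S)" by blast
  have eq: "P (n\<^sub>0 + i) \<inter> S = ((ideal_smult M I) ^^ i) (P n\<^sub>0 \<inter> S)" for i
    by (induction i) (simp_all add: n\<^sub>0)
  have "P n \<inter> S \<subseteq> T" if "n\<^sub>0 + j \<le> n" for n
    using P_antimono[OF that] ST[of "P n\<^sub>0 \<inter> S"] eq[of j] by blast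
  then show ?thesis by blast
qed

lemma P_Int_annihilated:
  assumes S: "submodule S R M" and IS: "\<And>a x. a \<in> I \<Longrightarrow> x \<in> S \<Longrightarrow> a \<odot>\<^bsub>M\<^esub> x = \<zero>\<^bsub>M\<^esub>"
  shows "\<exists>n\<^sub>0. \<forall>n\<ge>n\<^sub>0. P n \<inter> S = {\<zero>\<^bsub>M\<^esub>}"
proof -
  have "\<exists>n\<^sub>0. \<forall>n\<ge>n\<^sub>0. P n \<inter> S \<subseteq> {\<zero>\<^bsub>M\<^esub>}"
    by (rule weak_artin_rees[OF S submodule_zero, of 1])
      (use IS in \<open>auto simp: ideal_smult_subset_iff[OF submodule_zero]\<close>)
  then show ?thesis using submodule_simps(1)[OF S] submodule_simps(1)[OF subP] by blast
qed

lemma funpow_ideal_smult_subset: "N \<subseteq> carrier M \<Longrightarrow> ((ideal_smult M I) ^^ j) N \<subseteq> P j"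
proof (induction j)
  case (Suc j)
  then show ?case using ideal_smult_mono[of I I] by (simp add: P_Suc)
qed (simp add: ideal_power_module_0)

text \<open>Artin-Rees for the submodule \<open>a Q\<close>: multiplication by \<open>a\<close>
  commutes with \<open>I\<close>, so \<open>I\<^sup>j (a Q)\<close> is contained in
  \<open>a (Q \<inter> P j)\<close>. Thus a product \<open>a x\<close> that is deep in the
  filtration also comes from an element of \<open>Q\<close> in \<open>P j\<close>.\<close>

lemma colon_single:
  assumes Q: "submodule Q R M" and a: "a \<in> carrier R"
  shows "\<exists>n\<^sub>0. \<forall>n\<ge>n\<^sub>0. \<forall>x\<in>Q. a \<odot>\<^bsub>M\<^esub> x \<in> P n \<longrightarrow> (\<exists>y\<in>Q \<inter> P j. a \<odot>\<^bsub>M\<^esub> x = a \<odot>\<^bsub>M\<^esub> y)"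
proof -
  let ?f = "\<lambda>N. (\<lambda>x. a \<odot>\<^bsub>M\<^esub> x) ` N"
  have comm: "ideal_smult M I (?f N) \<subseteq> ?f (ideal_smult M I N)" if N: "submodule N R M" for N
  proof -
    have "b \<odot>\<^bsub>M\<^esub> (a \<odot>\<^bsub>M\<^esub> x) \<in> ?f (ideal_smult M I N)" if "b \<in> I" "x \<in> N" for b x
      using that a I_carrier submodule_simps(2)[OF N]
      by (intro image_eqI[of _ _ "b \<odot>\<^bsub>M\<^esub> x"])
        (auto simp: smult_assoc1[symmetric] R.m_comm subset_iff intro: ideal_smult.smult)
    then show ?thesis
      by (subst ideal_smult_subset_iff[OF submodule_smult_image[OF a submodule_ideal_smult[OF I N]]]) blast
  qed
  have sub: "submodule (((ideal_smult M I) ^^ i) Q) R M" for i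
    by (induction i) (simp_all add: Q submodule_ideal_smult[OF I])
  have subQ: "((ideal_smult M I) ^^ i) Q \<subseteq> Q" for i
  proof (induction i)
    case (Suc i)
    then show ?case using ideal_smult_subset[OF I sub[of i]] by simp
  qed simp
  have f: "((ideal_smult M I) ^^ i) N \<subseteq> ?f (((ideal_smult M I) ^^ i) Q)" if "N \<subseteq> ?f Q" for i N
  proof (induction i)
    case (Suc i)
    then show ?case using ideal_smult_mono[OF subset_refl Suc, of I] comm[OF sub[of i]] by simp
  qed (use that in simp)
  have "\<exists>n\<^sub>0. \<forall>n\<ge>n\<^sub>0. P n \<inter> ?f Q \<subseteq> ?f (Q \<inter> P j)"
  proof (rule weak_artin_rees)
    fix N assume "N \<subseteq> ?f Q"
    then have "((ideal_smult M I) ^^ j) N \<subseteq> ?f (((ideal_smult M I) ^^ j) Q)" by (rule f)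
    also have "\<dots> \<subseteq> ?f (Q \<inter> P j)"
      using subQ funpow_ideal_smult_subset[of Q j] submodule_simps(2)[OF Q] by blast
    finally show "((ideal_smult M I) ^^ j) N \<subseteq> ?f (Q \<inter> P j)" .
  qed (use a Q submodule_Int[OF Q subP] submodule_smult_image in blast)+
  then show ?thesis by blast
qed

text \<open>One generator at a time: a decomposition \<open>x = q + z\<close> with \<open>z\<close>
  killed by \<open>A\<close> is corrected by some \<open>y\<close> in \<open>P j\<close> with
  \<open>a y = a z\<close>, giving \<open>x = (q + y) + (z - y)\<close> with \<open>z - y\<close>
  killed by \<open>a\<close> as well.\<close>

lemma colon_finite:
  assumes "finite A" "A \<subseteq> carrier R"
  shows "\<exists>n\<^sub>0. \<forall>n\<ge>n\<^sub>0. colon_module M (P n) A \<subseteq> P j <+>\<^bsub>M\<^esub> colon_module M {\<zero>\<^bsub>M\<^esub>} A"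
  using assms
proof (induction A arbitrary: j)
  case empty
  have "colon_module M N {} = carrier M" for N by (simp add: colon_module_def)
  then show ?case using subset_set_add(2)[OF subP carrier_is_submodule] by auto
next
  case (insert a A)
  let ?Q = "colon_module M {\<zero>\<^bsub>M\<^esub>} A" and ?Q' = "colon_module M {\<zero>\<^bsub>M\<^esub>} (insert a A)"
  have Q: "submodule ?Q R M" and a: "a \<in> carrier R"
    using insert.prems submodule_colon_module[OF submodule_zero] by auto
  obtain m where m: "\<And>n x. m \<le> n \<Longrightarrow> x \<in> ?Q \<Longrightarrow> a \<odot>\<^bsub>M\<^esub> x \<in> P n \<Longrightarrow> \<exists>y\<in>?Q \<inter> P j. a \<odot>\<^bsub>M\<^esub> x = a \<odot>\<^bsub>M\<^esub> y"
    using colon_single[OF Q a, of j] by blast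
  \<comment> \<open>Depth \<open>m\<close> makes \<open>colon_single\<close> applicable to
    \<open>a z = a x - a q\<close>, and depth \<open>j\<close> keeps \<open>q\<close> in
    \<open>P j\<close>. The induction hypothesis is therefore needed at a depth other than
    \<open>j\<close>.\<close>
  define m' where "m' = max j m"
  obtain n\<^sub>0 where n\<^sub>0: "\<And>n. n\<^sub>0 \<le> n \<Longrightarrow> colon_module M (P n) A \<subseteq> P m' <+>\<^bsub>M\<^esub> ?Q"
    using insert.IH[of m'] insert.prems by blast
  have "x \<in> P j <+>\<^bsub>M\<^esub> ?Q'" if n: "max n\<^sub>0 m' \<le> n" and x: "x \<in> colon_module M (P n) (insert a A)" for n x
  proof -
    have "x \<in> colon_module M (P n) A" using x by (auto simp: colon_module_def)
    then obtain q z where q: "q \<in> P m'" and z: "z \<in> ?Q" and xqz: "x = q \<oplus>\<^bsub>M\<^esub> z"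
      using n\<^sub>0[of n] n by (auto simp: mem_set_add_iff subset_iff)
    have carr: "q \<in> carrier M" "z \<in> carrier M" using q z submodule_simps(2)[OF subP] submodule_simps(2)[OF Q] by auto
    have "a \<odot>\<^bsub>M\<^esub> x \<in> P m'"
      using x P_antimono[of m' n] n by (auto simp: colon_module_def)
    then have "a \<odot>\<^bsub>M\<^esub> q \<oplus>\<^bsub>M\<^esub> a \<odot>\<^bsub>M\<^esub> z \<in> P m'" using xqz a carr by (simp add: smult_r_distr)
    moreover have "a \<odot>\<^bsub>M\<^esub> q \<in> P m'" using submodule_simps(5)[OF subP a q] .
    ultimately have "a \<odot>\<^bsub>M\<^esub> z \<in> P m'"
      using submodule_add_cancel_left[OF subP] a carr by blast
    then obtain y where y: "y \<in> ?Q" "y \<in> P j" "a \<odot>\<^bsub>M\<^esub> z = a \<odot>\<^bsub>M\<^esub> y"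
      using m[of m' z] z by (auto simp: m'_def)
    have yc: "y \<in> carrier M" using y submodule_simps(2)[OF Q] by auto
    have "a \<odot>\<^bsub>M\<^esub> (z \<ominus>\<^bsub>M\<^esub> y) = \<zero>\<^bsub>M\<^esub>"
      using y(3) a carr yc by (simp add: M.minus_eq smult_r_distr smult_r_minus M.r_neg)
    then have zy: "z \<ominus>\<^bsub>M\<^esub> y \<in> ?Q'"
      using submodule_simps(4)[OF Q z y(1)] by (auto simp: colon_module_def)
    have "q \<in> P j" using q P_antimono[of j m'] by (auto simp: m'_def)
    then have "q \<oplus>\<^bsub>M\<^esub> y \<in> P j" using y submodule_simps(3)[OF subP] by auto
    moreover have "y \<oplus>\<^bsub>M\<^esub> (z \<ominus>\<^bsub>M\<^esub> y) = z"
      using carr yc M.add.m_lcomm[of y z "\<ominus>\<^bsub>M\<^esub> y"] by (simp add: M.minus_eq M.r_neg)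
    then have "x = (q \<oplus>\<^bsub>M\<^esub> y) \<oplus>\<^bsub>M\<^esub> (z \<ominus>\<^bsub>M\<^esub> y)"
      unfolding xqz using carr yc by (simp add: M.a_assoc)
    ultimately show ?thesis using set_addI zy by simp
  qed
  then show ?case by blast
qed

text \<open>The finite depth reached by \<open>colon_finite\<close> is raised to \<open>n\<close> by
  stabilization of the family \<open>N\<close>; the summand in the annihilated part does not
  interfere, because it lies in every colon.\<close>

lemma colon_P_subset:
  assumes J: "ideal J R" and IJ: "I \<subseteq> J"
  shows "\<exists>n\<^sub>0. \<forall>n\<ge>n\<^sub>0. colon_module M (P (Suc n)) J \<subseteq> P n <+>\<^bsub>M\<^esub> colon_module M {\<zero>\<^bsub>M\<^esub>} J"
proof -
  let ?S = "colon_module M {\<zero>\<^bsub>M\<^esub>} J"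
  have Jc: "J \<subseteq> carrier R" using ideal.Icarr[OF J] by blast
  note sub_colon = submodule_colon_module[OF subP Jc]
  \<comment> \<open>The colon is taken two degrees above \<open>n\<close>: then
    \<open>J N n \<subseteq> P (n + 2)\<close>, exactly one degree better than
    \<open>N (n + 1) \<subseteq> P (n + 1)\<close>.\<close>
  define N where "N n = colon_module M (P (Suc (Suc n))) J \<inter> P n" for n
  have sN: "submodule (N n) R M" for n unfolding N_def using submodule_Int[OF sub_colon subP] .
  have "\<exists>n\<^sub>0. \<forall>n\<ge>n\<^sub>0. N (Suc n) = ideal_smult M I (N n)"
  proof (rule ideal_smult_family_stabilizes[OF R fg I sN])
    fix n
    have "b \<odot>\<^bsub>M\<^esub> (a \<odot>\<^bsub>M\<^esub> x) \<in> P (Suc (Suc (Suc n)))"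
      if "a \<in> I" "x \<in> colon_module M (P (Suc (Suc n))) J" "b \<in> J" for a x b
    proof -
      have "b \<odot>\<^bsub>M\<^esub> (a \<odot>\<^bsub>M\<^esub> x) = a \<odot>\<^bsub>M\<^esub> (b \<odot>\<^bsub>M\<^esub> x)"
        using that I_carrier Jc by (auto simp: colon_module_def smult_assoc1[symmetric] R.m_comm subset_iff)
      then show ?thesis using that smult_P smult_colon_module by simp
    qed
    then show "ideal_smult M I (N n) \<subseteq> N (Suc n)"
      unfolding ideal_smult_subset_iff[OF sN]
      using I_carrier smult_P[of _ _ n] by (auto simp: N_def colon_module_def)
  qed (simp add: N_def)
  then obtain k where k: "\<And>n. k \<le> n \<Longrightarrow> N (Suc n) = ideal_smult M I (N n)" by blast
  \<comment> \<open>Writing \<open>n = l + 1\<close>, stabilization gives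
    \<open>N n = I N l\<close>, and \<open>I \<subseteq> J\<close> sends \<open>N l\<close> into
    \<open>P (l + 2)\<close>.\<close>
  have up: "N n \<subseteq> P (Suc n)" if n: "Suc k \<le> n" for n
  proof -
    obtain l where l: "n = Suc l" "k \<le> l" using n by (cases n) auto
    have "ideal_smult M I (N l) \<subseteq> P (Suc (Suc l))"
      unfolding ideal_smult_subset_iff[OF subP] N_def using IJ smult_colon_module by blast
    then show ?thesis using k l by simp
  qed
  \<comment> \<open>For \<open>i < n\<close> the colon of \<open>P (Suc n)\<close> is contained in
    that of \<open>P (i + 2)\<close>, so \<open>y\<close> lies in \<open>N i\<close> and
    \<open>up\<close> applies.\<close>
  have climb: "y \<in> P n" if "Suc k \<le> i" "i \<le> n" "y \<in> P i" "y \<in> colon_module M (P (Suc n)) J" for y i n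
    using that(2,1,3)
  proof (induction i rule: inc_induct)
    case (step i)
    have "y \<in> colon_module M (P (Suc (Suc i))) J"
      using that(4) P_antimono[of "Suc (Suc i)" "Suc n"] step by (auto simp: colon_module_def)
    then have "y \<in> N i" using step by (simp add: N_def)
    then show ?case using up[of i] step by auto
  qed simp
  obtain A where A: "A \<subseteq> carrier R" "finite A" "J = Idl A"
    using noetherian_ring.finetely_gen[OF R J] by blast
  obtain m where m: "\<And>n. m \<le> n \<Longrightarrow> colon_module M (P n) J \<subseteq> P (Suc k) <+>\<^bsub>M\<^esub> ?S"
    using colon_finite[OF A(2,1), of "Suc k"] unfolding A(3) colon_module_Idl[OF subP A(1)]
      colon_module_Idl[OF submodule_zero A(1)] by blast
  have "x \<in> P n <+>\<^bsub>M\<^esub> ?S" if n: "max m (Suc k) \<le> n" and x: "x \<in> colon_module M (P (Suc n)) J" for n x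
  proof -
    obtain y w where y: "y \<in> P (Suc k)" and w: "w \<in> ?S" and xyw: "x = y \<oplus>\<^bsub>M\<^esub> w"
      using m[of "Suc n"] n x by (auto simp: mem_set_add_iff subset_iff)
    have "?S \<subseteq> colon_module M (P (Suc n)) J"
      using submodule_simps(1)[OF subP, of "Suc n"] by (auto simp: colon_module_def)
    then have "y \<in> colon_module M (P (Suc n)) J"
      using submodule_add_cancel_right[OF sub_colon, of w _ y] w x xyw submodule_simps(2)[OF subP y] by auto
    then have "y \<in> P n" using climb[of "Suc k" n y] y n by simp
    then show ?thesis using w xyw set_addI by simp
  qed
  then show ?thesis by blast
qed

end

section \<open>Leading coefficients\<close>

text \<open>The common form of the two polynomials: \<open>k = t\<close> for the Hilbert
  coefficients, and \<open>k = t - 1\<close> for the irreducible coefficients when \<open>t\<close>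
  is positive. The leading coefficient is \<open>c 0\<close> up to the factor
  \<open>1 / k!\<close>.\<close>

definition binom_sum :: "nat \<Rightarrow> (nat \<Rightarrow> int) \<Rightarrow> nat \<Rightarrow> int" where
  "binom_sum k c n = (\<Sum>i\<le>k. (-1) ^ i * c i * int ((n + k - i) choose (k - i)))"

lemma binom_sum_0 [simp]: "binom_sum 0 c n = c 0"
  by (simp add: binom_sum_def)

lemma binom_sum_diff: "binom_sum k (\<lambda>i. c i - d i) n = binom_sum k c n - binom_sum k d n"
  by (simp add: binom_sum_def sum_subtractf[symmetric] algebra_simps)

text \<open>By Pascal's rule every term loses one degree and keeps its coefficient, while the
  constant term cancels. So \<open>e 0\<close> is also the first coefficient of the polynomial for
  the lengths of \<open>P n / P (n + 1)\<close>.\<close>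

lemma binom_sum_Suc_diff:
  "binom_sum (Suc k) c (Suc n) - binom_sum (Suc k) c n = binom_sum k c (Suc n)"
proof -
  have "binom_sum (Suc k) c (Suc n) - binom_sum (Suc k) c n
    = (\<Sum>i\<le>Suc k. (-1) ^ i * c i * (int ((Suc n + Suc k - i) choose (Suc k - i)) - int ((n + Suc k - i) choose (Suc k - i))))"
    by (simp add: binom_sum_def sum_subtractf[symmetric] algebra_simps del: sum.atMost_Suc)
  also have "\<dots> = (\<Sum>i\<le>k. (-1) ^ i * c i * (int ((Suc n + Suc k - i) choose (Suc k - i)) - int ((n + Suc k - i) choose (Suc k - i))))"
    by simp
  also have "\<dots> = binom_sum k c (Suc n)"
    unfolding binom_sum_def
  proof (rule sum.cong)
    fix i assume "i \<in> {..k}"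
    then obtain m where m: "k = i + m" by (auto simp: le_iff_add)
    then have "Suc n + Suc k - i = Suc (Suc (n + m))" "n + Suc k - i = Suc (n + m)"
      "Suc k - i = Suc m" "Suc n + k - i = Suc (n + m)" "k - i = m" by auto
    then show "(-1) ^ i * c i * (int ((Suc n + Suc k - i) choose (Suc k - i)) - int ((n + Suc k - i) choose (Suc k - i)))
        = (-1) ^ i * c i * int ((Suc n + k - i) choose (k - i))" by simp
  qed simp
  finally show ?thesis .
qed

text \<open>Integer values that decrease strictly drop by at least 1 in each step, hence below every
  bound.\<close>

lemma eventually_less_if_diff_neg:
  fixes g :: "nat \<Rightarrow> int"
  assumes "\<forall>\<^sub>F n in sequentially. g (Suc n) < g n"
  shows "\<forall>\<^sub>F n in sequentially. g n < s"
proof -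
  obtain N where N: "\<And>n. N \<le> n \<Longrightarrow> g (Suc n) < g n"
    using assms by (auto simp: eventually_sequentially)
  have le: "g (N + j) \<le> g N - int j" for j
  proof (induction j)
    case (Suc j)
    then show ?case using N[of "N + j"] by simp
  qed simp
  have "g n < s" if "N + nat (g N - s + 1) \<le> n" for n
  proof -
    have "int (n - N) \<ge> g N - s + 1" and "N + (n - N) = n" using that by auto
    then show ?thesis using le[of "n - N"] by simp
  qed
  then show ?thesis by (auto simp: eventually_sequentially)
qed

text \<open>Induction on the degree through differences. An arbitrary bound \<open>s\<close> is
  reached only in positive degree, since degree 0 is constant; this is where the case
  \<open>t = 1\<close> separates from \<open>t > 1\<close>.\<close>

lemma binom_sum_eventually_neg:
  assumes "c 0 < 0"
  shows "\<forall>\<^sub>F n in sequentially. binom_sum k c n < 0"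
    and "\<forall>\<^sub>F n in sequentially. binom_sum (Suc k) c n < s"
proof -
  have step: "\<forall>\<^sub>F n in sequentially. binom_sum (Suc k) c n < s"
    if "\<forall>\<^sub>F n in sequentially. binom_sum k c n < 0" for k s
  proof (rule eventually_less_if_diff_neg)
    show "\<forall>\<^sub>F n in sequentially. binom_sum (Suc k) c (Suc n) < binom_sum (Suc k) c n"
      using eventually_compose_filterlim[OF that filterlim_Suc]
    proof (eventually_elim)
      case (elim n)
      then show ?case using binom_sum_Suc_diff[of k c n] by linarith
    qed
  qed
  show neg: "\<forall>\<^sub>F n in sequentially. binom_sum k c n < 0"
    by (induction k) (use assms step in auto)
  show "\<forall>\<^sub>F n in sequentially. binom_sum (Suc k) c n < s"
    using step[OF neg] .
qed

lemma binom_sum_leading_nonneg: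
  assumes "\<forall>\<^sub>F n in sequentially. s \<le> binom_sum (Suc k) c n"
  shows "0 \<le> c 0"
proof (rule ccontr)
  assume "\<not> 0 \<le> c 0"
  then have "\<forall>\<^sub>F n in sequentially. binom_sum (Suc k) c n < s"
    using binom_sum_eventually_neg(2)[of c] by simp
  with assms have "\<forall>\<^sub>F n in sequentially. False"
    by eventually_elim simp
  then show False by simp
qed

lemma ereal_of_enat_eq_of_int:
  assumes "ereal_of_enat x = ereal (real_of_int z)"
  obtains m where "x = enat m" "int m = z"
  using assms by (cases x) (auto dest: of_int_eq_iff[THEN iffD1, rotated])

section \<open>Lengths of the colon quotients and of the graded pieces\<close>

context noetherian_module
begin

lemma rel_length_add_disjoint:
  assumes "submodule S R M" "P m \<inter> S = {\<zero>\<^bsub>M\<^esub>}"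
  shows "rel_length (P m) (P m <+>\<^bsub>M\<^esub> S) = rel_length {\<zero>\<^bsub>M\<^esub>} S"
  using rel_length_second_iso[OF subP assms(1), of m] assms(2) by simp

lemma eventually_P_Int_colon_zero:
  assumes J: "ideal J R" and IJ: "I \<subseteq> J"
  shows "\<forall>\<^sub>F n in sequentially. P n \<inter> colon_module M {\<zero>\<^bsub>M\<^esub>} J = {\<zero>\<^bsub>M\<^esub>}"
proof -
  have Jc: "J \<subseteq> carrier R" using ideal.Icarr[OF J] by blast
  show ?thesis
    unfolding eventually_sequentially
    using P_Int_annihilated[OF submodule_colon_module[OF submodule_zero Jc]] IJ
    by (simp add: colon_module_def subset_iff)
qed

context
  fixes J assumes J: "ideal J R" and IJ: "I \<subseteq> J"
begin

abbreviation "S \<equiv> colon_module M {\<zero>\<^bsub>M\<^esub>} J"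
abbreviation "C n \<equiv> colon_module M (P n) J"

lemma sub_S: "submodule S R M" and sub_C: "submodule (C n) R M"
  using ideal.Icarr[OF J] by (auto intro!: submodule_colon_module submodule_zero subP)

lemma S_subset_C: "S \<subseteq> C n"
  using submodule_simps(1)[OF subP, of n] by (auto simp: colon_module_def)

lemma P_subset_C: "P n \<subseteq> C n"
  using submodule_simps(2)[OF subP] submodule_simps(5)[OF subP] ideal.Icarr[OF J] by (auto simp: colon_module_def)

text \<open>As \<open>S\<close> meets \<open>P n\<close> in zero, it embeds into
  \<open>L / P n\<close> with image \<open>(P n + S) / P n\<close>.\<close>

lemma socle_length_le:
  assumes "submodule L R M" "S \<subseteq> L" "P n \<subseteq> L" "P n \<inter> S = {\<zero>\<^bsub>M\<^esub>}"
  shows "rel_length {\<zero>\<^bsub>M\<^esub>} S \<le> rel_length (P n) L"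
proof -
  have "P n <+>\<^bsub>M\<^esub> S \<subseteq> L"
    using set_add_subset_iff[OF subP sub_S assms(1)] assms by simp
  then show ?thesis
    using rel_length_add_disjoint[OF sub_S assms(4)] rel_length_mono by metis
qed

lemma rel_length_P_add_S:
  assumes "P n \<inter> S = {\<zero>\<^bsub>M\<^esub>}"
  shows "rel_length (P (Suc n)) (P n <+>\<^bsub>M\<^esub> S)
    = rel_length (P (Suc n)) (P n) + rel_length {\<zero>\<^bsub>M\<^esub>} S"
  using rel_length_add[OF subP subP submodule_set_add[OF subP sub_S]]
    subset_set_add(1)[OF subP sub_S] P_antimono[of n "Suc n"] rel_length_add_disjoint[OF sub_S assms]
  by simp

lemma eventually_rel_length_C_le:
  "\<forall>\<^sub>F n in sequentially. rel_length (P (Suc n)) (C (Suc n))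
    \<le> rel_length (P (Suc n)) (P n) + rel_length {\<zero>\<^bsub>M\<^esub>} S"
proof -
  have "\<forall>\<^sub>F n in sequentially. C (Suc n) \<subseteq> P n <+>\<^bsub>M\<^esub> S"
    using colon_P_subset[OF J IJ] by (simp add: eventually_sequentially)
  with eventually_P_Int_colon_zero[OF J IJ] show ?thesis
    by eventually_elim (use rel_length_mono rel_length_P_add_S in metis)
qed

text \<open>The equation at the single index \<open>m\<close> propagates upwards because
  \<open>P (n + 1) = I P n\<close> and \<open>a (b x) = b (a x)\<close>: if \<open>a\<close> raises
  the depth on \<open>P n\<close>, it does so on \<open>P (n + 1)\<close>. Then
  \<open>P n + S\<close> is contained in the colon.\<close>

lemma eventually_rel_length_C_eq:
  assumes J_eq: "J = colon_ring R M (P (Suc m)) (P m)"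
  shows "\<forall>\<^sub>F n in sequentially. rel_length (P (Suc n)) (C (Suc n))
    = rel_length (P (Suc n)) (P n) + rel_length {\<zero>\<^bsub>M\<^esub>} S"
proof -
  have JP: "\<forall>a\<in>J. \<forall>x\<in>P n. a \<odot>\<^bsub>M\<^esub> x \<in> P (Suc n)" if "m \<le> n" for n
    using that
  proof (induction n rule: dec_induct)
    case base
    then show ?case using J_eq by (auto simp: colon_ring_def)
  next
    case (step n)
    show ?case
    proof (intro ballI)
      fix a x assume a: "a \<in> J"
      assume "x \<in> P (Suc n)"
      then have "x \<in> ideal_smult M I (P n)" by (simp add: P_Suc)
      then show "a \<odot>\<^bsub>M\<^esub> x \<in> P (Suc (Suc n))"
      proof induction
        case (smult b x)
        have "a \<odot>\<^bsub>M\<^esub> (b \<odot>\<^bsub>M\<^esub> x) = b \<odot>\<^bsub>M\<^esub> (a \<odot>\<^bsub>M\<^esub> x)"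
          using a smult I_carrier ideal.Icarr[OF J] submodule_simps(2)[OF subP]
          by (simp add: smult_assoc1[symmetric] R.m_comm subset_iff)
        then show ?case using step.IH a smult smult_P by simp
      next
        case (add x y)
        have "x \<in> carrier M" "y \<in> carrier M"
          using add submodule_simps(2)[OF submodule_ideal_smult[OF I subP]] by auto
        then show ?case
          using add submodule_simps(3)[OF subP] a ideal.Icarr[OF J] by (simp add: smult_r_distr)
      qed
    qed
  qed
  have "\<forall>\<^sub>F n in sequentially. C (Suc n) \<subseteq> P n <+>\<^bsub>M\<^esub> S"
    using colon_P_subset[OF J IJ] by (simp add: eventually_sequentially)
  with eventually_P_Int_colon_zero[OF J IJ] eventually_ge_at_top[of m] show ?thesis
  proof eventually_elim
    case (elim n)
    have "P n \<subseteq> C (Suc n)"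
      using JP[of n] elim submodule_simps(2)[OF subP] by (auto simp: colon_module_def)
    then have "P n <+>\<^bsub>M\<^esub> S \<subseteq> C (Suc n)"
      using S_subset_C set_add_subset_iff[OF subP sub_S sub_C] by simp
    with elim have "C (Suc n) = P n <+>\<^bsub>M\<^esub> S" by blast
    then show ?case using rel_length_P_add_S elim by simp
  qed
qed

text \<open>The first bound is the inequality for dimension 0; the second is used in positive
  dimension to see that the socle has finite length.\<close>

lemma eventually_socle_length_le:
  "\<forall>\<^sub>F n in sequentially. rel_length {\<zero>\<^bsub>M\<^esub>} S \<le> rel_length (P (Suc n)) (carrier M)
    \<and> rel_length {\<zero>\<^bsub>M\<^esub>} S \<le> rel_length (P (Suc n)) (C (Suc n))"
  using eventually_compose_filterlim[OF eventually_P_Int_colon_zero[OF J IJ] filterlim_Suc]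
proof eventually_elim
  case (elim n)
  then show ?case
    using socle_length_le[OF carrier_is_submodule _ _ elim] socle_length_le[OF sub_C S_subset_C P_subset_C elim]
      submodule_simps(2)[OF sub_S] submodule_simps(2)[OF subP] by blast
qed

end

text \<open>Additivity of length along \<open>P (n + 2) \<subseteq> P (n + 1) \<subseteq> M\<close>
  turns the graded piece into a difference of two finite lengths, which
  \<open>binom_sum_Suc_diff\<close> evaluates.\<close>

lemma eventually_rel_length_P:
  assumes "\<forall>\<^sub>F n in sequentially.
    ereal_of_enat (rel_length (P (Suc n)) (carrier M)) = ereal (real_of_int (binom_sum (Suc k) e n))"
  shows "\<forall>\<^sub>F n in sequentially. \<exists>d. rel_length (P (Suc n)) (P n) = enat d \<and> int d = binom_sum k e n"
proof -
  have "\<forall>\<^sub>F n in sequentially. \<exists>d. rel_length (P (Suc (Suc n))) (P (Suc n)) = enat d \<and> int d = binom_sum k e (Suc n)"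
    using assms eventually_compose_filterlim[OF assms filterlim_Suc]
  proof eventually_elim
    case (elim n)
    obtain p q where p: "rel_length (P (Suc n)) (carrier M) = enat p" "int p = binom_sum (Suc k) e n"
      and q: "rel_length (P (Suc (Suc n))) (carrier M) = enat q" "int q = binom_sum (Suc k) e (Suc n)"
      using elim ereal_of_enat_eq_of_int by metis
    have "enat q = rel_length (P (Suc (Suc n))) (P (Suc n)) + enat p"
      using rel_length_add[OF subP subP carrier_is_submodule P_antimono[of "Suc n" "Suc (Suc n)"]]
        submodule_simps(2)[OF subP] p(1) q(1) by auto
    then obtain d where "rel_length (P (Suc (Suc n))) (P (Suc n)) = enat d" "q = d + p"
      by (cases "rel_length (P (Suc (Suc n))) (P (Suc n))") auto
    then show ?case using p(2) q(2) binom_sum_Suc_diff[of k e n] by auto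
  qed
  \<comment> \<open>The difference formula speaks of the index \<open>Suc n\<close>; the shift is
    harmless for large indices.\<close>
  then show ?thesis by (subst eventually_sequentially_Suc[symmetric])
qed

end

text \<open>In dimension 0 the colon condition does not force equality: for
  \<open>R = M = k[x]/(x^2)\<close> over a field \<open>k\<close> and \<open>I = \<mm> = (x)\<close>
  it holds with \<open>n = 0\<close>, but \<open>e 0 = 2\<close> and \<open>f 0 = 1\<close>. Hence
  the equality clause is restricted to \<open>t \<noteq> 0\<close>.\<close>

theorem theorem1p1:
  fixes R :: "('a, 'r) ring_scheme" and M :: "('a, 'b, 'm) module_scheme"
    and \<mm> I :: "'a set" and t :: nat and e f :: "nat \<Rightarrow> int"
  assumes "noetherian_local_ring R \<mm>"
    and "primary_to R \<mm> I"
    and "finitely_generated_module R M"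
    and "carrier M \<noteq> {\<zero>\<^bsub>M\<^esub>}"
    and "module_dim R M = enat t"
    and "hilbert_coefficients R I M t e"
    and "irreducible_coefficients R \<mm> I M t f"
  shows "let bound = (if t = 1 then ereal (real_of_int (e 0)) + ereal_of_enat (socle_length R \<mm> M)
                      else ereal (real_of_int (e 0)))
         in ereal (real_of_int (f 0)) \<le> bound \<and>
            (t \<noteq> 0 \<and>
             (\<exists>n. \<mm> = colon_ring R M (ideal_power_module R I (n + 1) M) (ideal_power_module R I n M))
             \<longrightarrow> ereal (real_of_int (f 0)) = bound)"
proof -
  have R: "noetherian_ring R" and \<mm>: "ideal \<mm> R"
    using assms(1) by (auto simp: noetherian_local_ring_def maximalideal_def)
  have I: "ideal I R" and rad: "radical_ideal R I = \<mm>"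
    using assms(2) by (auto simp: primary_to_def primary_ideal_def)
  have M: "module R M" using assms(3) by (simp add: finitely_generated_module_def)
  interpret noetherian_module R M I
    by (intro noetherian_module.intro noetherian_module_axioms.intro M R assms(3) I)
  have I\<mm>: "I \<subseteq> \<mm>"
  proof
    fix a assume "a \<in> I"
    then have "a \<in> carrier R" "a [^]\<^bsub>R\<^esub> (1::nat) \<in> I" using I_carrier by auto
    then show "a \<in> \<mm>" unfolding rad[symmetric] radical_ideal_def by blast
  qed
  let ?S = "colon_module M {\<zero>\<^bsub>M\<^esub>} \<mm>" and ?C = "\<lambda>n. colon_module M (P n) \<mm>"
  define s where "s = rel_length {\<zero>\<^bsub>M\<^esub>} ?S"
  define D where "D n = rel_length (P (Suc n)) (?C (Suc n))" for n
  have s: "socle_length R \<mm> M = s"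
    unfolding socle_length_def s_def by (rule module_length_restrict[OF sub_S[OF \<mm> I\<mm>]])
  have hilb: "\<forall>\<^sub>F n in sequentially.
      ereal_of_enat (rel_length (P (Suc n)) (carrier M)) = ereal (real_of_int (binom_sum t e n))"
    using assms(6) unfolding hilbert_coefficients_def binom_sum_def[symmetric]
    by (simp add: module_length_quotient subP)
  show ?thesis
  proof (cases t)
    case 0
    \<comment> \<open>For \<open>t = 0\<close> the number \<open>f 0\<close> is \<open>s\<close> by
      convention, and the Hilbert polynomial is the constant \<open>e 0\<close>.\<close>
    have "\<forall>\<^sub>F n in sequentially. ereal_of_enat s \<le> ereal (real_of_int (e 0))"
      using hilb eventually_socle_length_le[OF \<mm> I\<mm>]
    proof eventually_elim
      case (elim n)
      then have "s \<le> rel_length (P (Suc n)) (carrier M)" by (simp add: s_def)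
      then have "ereal_of_enat s \<le> ereal_of_enat (rel_length (P (Suc n)) (carrier M))"
        unfolding ereal_of_enat_le_iff .
      then show ?case unfolding elim(1) using 0 by simp
    qed
    then show ?thesis
      using assms(7) 0 by (simp add: irreducible_coefficients_def s)
  next
    case (Suc k)
    have irr: "\<forall>\<^sub>F n in sequentially. ereal_of_enat (D n) = ereal (real_of_int (binom_sum k f n))"
      using assms(7) Suc P_subset_C[OF \<mm> I\<mm>] sub_C[OF \<mm> I\<mm>] subP
      by (simp add: irreducible_coefficients_def module_length_subquotient D_def binom_sum_def lessThan_Suc_atMost)
    have grad: "\<forall>\<^sub>F n in sequentially. \<exists>d. rel_length (P (Suc n)) (P n) = enat d \<and> int d = binom_sum k e n"
      using eventually_rel_length_P hilb Suc by simp
    \<comment> \<open>The colon quotient has finite length by \<open>irr\<close>, and the socle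
      embeds into it. From here on all comparisons are between integers.\<close>
    have "\<forall>\<^sub>F n in sequentially. s \<noteq> \<infinity>"
      using irr eventually_socle_length_le[OF \<mm> I\<mm>]
    proof eventually_elim
      case (elim n)
      obtain p where "D n = enat p"
        using elim(1) by (rule ereal_of_enat_eq_of_int)
      then have "s \<le> enat p" using elim(2) by (simp add: s_def D_def)
      then show ?case by (cases s) auto
    qed
    then obtain r where r: "s = enat r" by auto
    have le: "\<forall>\<^sub>F n in sequentially. binom_sum k f n \<le> binom_sum k e n + int r"
      using irr grad eventually_rel_length_C_le[OF \<mm> I\<mm>]
    proof eventually_elim
      case (elim n)
      obtain p where "D n = enat p" "int p = binom_sum k f n"
        using elim(1) by (rule ereal_of_enat_eq_of_int)
      then show ?case using elim(2,3) r by (auto simp: D_def s_def[symmetric])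
    qed
    have eq: "\<forall>\<^sub>F n in sequentially. binom_sum k f n = binom_sum k e n + int r"
      if m: "\<mm> = colon_ring R M (P (Suc m)) (P m)" for m
      using irr grad eventually_rel_length_C_eq[OF \<mm> I\<mm> m]
    proof eventually_elim
      case (elim n)
      obtain p where "D n = enat p" "int p = binom_sum k f n"
        using elim(1) by (rule ereal_of_enat_eq_of_int)
      then show ?case using elim(2,3) r by (auto simp: D_def s_def[symmetric])
    qed
    show ?thesis
    proof (cases k)
      case 0
      \<comment> \<open>For \<open>t = 1\<close> both polynomials are constants, so
        \<open>le\<close> and \<open>eq\<close> are already statements about \<open>f 0\<close> and
        \<open>e 0\<close>, and the length of the socle remains visible.\<close>
      have "f 0 \<le> e 0 + int r" using le 0 by simp
      moreover have "f 0 = e 0 + int r" if "\<mm> = colon_ring R M (P (Suc m)) (P m)" for m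
        using eq[OF that] 0 by simp
      moreover have "ereal (real_of_int (e 0)) + ereal_of_enat s = ereal (real_of_int (e 0 + int r))"
        by (simp add: r)
      ultimately show ?thesis
        using Suc 0 by (auto simp: s Let_def)
    next
      case (Suc l)
      \<comment> \<open>In positive degree a constant \<open>b\<close> cannot make up for a negative
        leading coefficient of the difference.\<close>
      have lead: "c 0 \<le> d 0" if "\<forall>\<^sub>F n in sequentially. binom_sum k c n \<le> binom_sum k d n + b" for c d b
      proof -
        have "\<forall>\<^sub>F n in sequentially. - b \<le> binom_sum (Suc l) (\<lambda>i. d i - c i) n"
          using that by eventually_elim (simp add: Suc binom_sum_diff)
        from binom_sum_leading_nonneg[OF this] show ?thesis by simp
      qed
      have "f 0 \<le> e 0" using lead[OF le] .
      moreover have "f 0 = e 0" if "\<mm> = colon_ring R M (P (Suc m)) (P m)" for m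
      proof (rule antisym)
        show "e 0 \<le> f 0"
          \<comment> \<open>The equality is read backwards, as \<open>e\<close>-polynomial \<le>
            \<open>f\<close>-polynomial minus \<open>r\<close>.\<close>
          by (rule lead[of _ _ "- int r"]) (use eq[OF that] in \<open>eventually_elim, simp\<close>)
      qed (rule \<open>f 0 \<le> e 0\<close>)
      ultimately show ?thesis
        using \<open>t = Suc k\<close> Suc by (auto simp: Let_def)
    qed
  qed
qed

end
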